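(* Let $\mathcal{K}^{\langle 0\rangle}$ be a simple nested fractal in $\mathbb{R}^2$ with $k\ge 3$ essential fixed points, and let $\mathcal{K}^{\langle\infty\rangle}$ be the corresponding unbounded simple nested fractal. Assume that either 1) $k\neq 6$, or 2) $k=6$ but $\mathcal{B}_{\mathcal{K}^{\langle 1\rangle}}\notin\mathcal{K}^{\langle 1\rangle}$. Let $W_i, W_{i+1}$ be two neighboring slices of $\mathcal{K}^{\langle 1\rangle}$. Then $\mathcal{K}^{\langle\infty\rangle}$ has the good labelling property (GLP) if and only if the vertices of the $0$-complexes in $W_i\cup W_{i+1}$ can be well labeled.
   Context: Simple nested fractal (SNF). Let $\Psi_i:\mathbb{R}^2\to\mathbb{R}^2$, $\Psi_i(x)=x/L+\nu_i$, $i=1,\dots,N$, with $L>1$, $\nu_i\in\mathbb{R}^2$, and one of the $\nu_i$ equal to $0$. $\mathcal{K}^{\langle 0\rangle}$ is the unique nonempty compact set with $\mathcal{K}^{\langle 0\rangle}=\bigcup_{i=1}^N\Psi_i(\mathcal{K}^{\langle 0\rangle})$. Let $F$ be the set of fixed points of the $\Psi_i$. A point $x\in F$ is an essential fixed point if there are another fixed point $y\in F$ and two different maps $\Psi_i,\Psi_j$ with $\Psi_i(x)=\Psi_j(y)$. $V_0^{\langle 0\rangle}$ is the set of essential fixed points and $k=\#V_0^{\langle 0\rangle}$. $\mathcal{K}^{\langle 0\rangle}$ is an SNF if: (1) $k\ge 2$; (2) (Open Set Condition) there is an open $U\subset\mathbb{R}^2$ with $\Psi_i(U)\cap\Psi_j(U)=\emptyset$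 for $i\ne j$ and $\bigcup_i\Psi_i(U)\subseteq U$; (3) (Nesting) $\Psi_i(\mathcal{K}^{\langle 0\rangle})\cap\Psi_j(\mathcal{K}^{\langle 0\rangle})=\Psi_i(V_0^{\langle 0\rangle})\cap\Psi_j(V_0^{\langle 0\rangle})$ for $i\neq j$; (4) (Symmetry) for $x,y\in V_0^{\langle 0\rangle}$ let $S_{x,y}$ be the reflection in the line perpendicularly bisecting $[x,y]$; for all $i\in\{1,\dots,N\}$ and all $x,y\in V_0^{\langle 0\rangle}$ there is $j\in\{1,\dots,N\}$ with $S_{x,y}(\Psi_i(V_0^{\langle 0\rangle}))=\Psi_j(V_0^{\langle 0\rangle})$; (5) (Connectivity) the graph on $V_{-1}^{\langle 0\rangle}=\bigcup_i\Psi_i(V_0^{\langle 0\rangle})$ in which $x,y$ are joined iff $x,y\in\Psi_i(\mathcal{K}^{\langle 0\rangle})$ for some $i$ is connected. Throughout $k\ge 3$; it is known that $V_0^{\langle 0\rangle}$ is then the vertex set of a regular $k$-gon. Complexes. $\mathcal{K}^{\langle M\rangle}=L^M\mathcal{K}^{\langle 0\rangle}$ and $\mathcal{K}^{\langle\infty\rangle}=\bigcup_{M\ge 0}\mathcal{K}^{\langle M\rangle}$ (the unbounded SNF). A $0$-complex is a set $\Delta_0=\mathcal{K}^{\langle 0\rangle}+\nu_{\Delta_0}\subset\mathcal{K}^{\langle\infty\rangle}$ with $\nu_{\Delta_0}=\sum_{j=1}^{J}L^j\nu_{i_j}$, $J\ge 1$, $\nu_{i_j}\in\{\nu_1,\dots,\nu_N\}$;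 its vertex set is $V(\Delta_0)=V_0^{\langle 0\rangle}+\nu_{\Delta_0}$. The $0$-complexes in $\mathcal{K}^{\langle 1\rangle}$ are the sets $\mathcal{K}^{\langle 0\rangle}+L\nu_i$, $i=1,\dots,N$. $V_0^{\langle\infty\rangle}$ is the set of vertices of all $0$-complexes. The vertices of $\mathcal{K}^{\langle 1\rangle}$ are the points of $L V_0^{\langle 0\rangle}$. $\mathcal{B}_{\Delta_0}$ and $\mathcal{B}_{\mathcal{K}^{\langle 1\rangle}}$ denote the barycenters of $\Delta_0$ and $\mathcal{K}^{\langle 1\rangle}$ (the centers of the regular $k$-gons spanned by their vertices). GLP. Let $\mathcal{A}$ be a set of $k$ labels, and let $\mathcal{R}_0$ be the set of the $k$ rotations around the barycenter of $\mathcal{K}^{\langle 0\rangle}$ mapping $V_0^{\langle 0\rangle}$ onto itself. $\mathcal{K}^{\langle\infty\rangle}$ has the GLP if there is $\ell:V_0^{\langle\infty\rangle}\to\mathcal{A}$ whose restriction to $V_0^{\langle 0\rangle}$ is a bijection onto $\mathcal{A}$ and such that for every $0$-complex $\Delta_0=\mathcal{K}^{\langle 0\rangle}+\nu_{\Delta_0}$ there is $R_{\Delta_0}\in\mathcal{R}_0$ with $\ell(v)=\ell(R_{\Delta_0}(v-\nu_{\Delta_0}))$ for all $v\in V(\Delta_0)$. (By self-similarity the analogous property for complexes of any other scale $L^M$, $M\in\mathbb{Z}$, is equivalent.) Well labeling of a family of complexes. The vertices of a family $\mathcal{D}$ of $0$-complexes can be well labeled if there are a bijection $\ell_0:V_0^{\langle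 0\rangle}\to\mathcal{A}$ and a map $\ell:\bigcup_{\Delta_0\in\mathcal{D}}V(\Delta_0)\to\mathcal{A}$ such that for each $\Delta_0=\mathcal{K}^{\langle 0\rangle}+\nu_{\Delta_0}\in\mathcal{D}$ there is $R\in\mathcal{R}_0$ with $\ell(v)=\ell_0(R(v-\nu_{\Delta_0}))$ for all $v\in V(\Delta_0)$ (each complex carries the complete set of labels in the same cyclic order). Slices. The $k$ half-lines from $\mathcal{B}_{\mathcal{K}^{\langle 1\rangle}}$ through the vertices of $\mathcal{K}^{\langle 1\rangle}$ divide the plane into $k$ open angles of measure $\frac{2\pi}{k}$. The area $U_i$ ($i=1,\dots,k$, numbered counter-clockwise, indices mod $k$) is the $i$-th open angle together with its left bounding half-line (left as seen from $\mathcal{B}_{\mathcal{K}^{\langle 1\rangle}}$) without the initial point $\mathcal{B}_{\mathcal{K}^{\langle 1\rangle}}$. The slice $W_i$ is the union (family) of those $0$-complexes $\Delta_0\subset\mathcal{K}^{\langle 1\rangle}$ whose barycenter $\mathcal{B}_{\Delta_0}$ lies in $U_i$. *)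

theory Defs
  imports "HOL-Analysis.Analysis"
begin

text \<open>
  The Euclidean plane is the type \<^typ>\<open>complex\<close>; multiplication by \<open>cis t\<close> is the
  counter-clockwise rotation by \<open>t\<close> around the origin. The maps are indexed by \<open>{1..N}\<close>.
\<close>

text \<open>For the vertices of a regular polygon this is the center of the polygon.\<close>

definition barycenter :: "complex set \<Rightarrow> complex"
  where "barycenter P = (\<Sum>p\<in>P. p) /\<^sub>R real (card P)"

definition bisector_reflection :: "complex \<Rightarrow> complex \<Rightarrow> complex \<Rightarrow> complex"
  where "bisector_reflection x y z =
    z - (2 * ((z - midpoint x y) \<bullet> (x - y)) / (norm (x - y))\<^sup>2) *\<^sub>R (x - y)"

text \<open>\<open>K\<close> is \<open>\<K>\<^sup>\<langle>\<^sup>0\<^sup>\<rangle>\<close>; the equation it satisfies is an assumption of the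
  locale \<open>simple_nested_fractal\<close> below.\<close>

locale similitude_system =
  fixes L :: real and N :: nat and \<nu> :: "nat \<Rightarrow> complex" and K :: "complex set"
begin

definition \<Psi> :: "nat \<Rightarrow> complex \<Rightarrow> complex"
  where "\<Psi> i x = x /\<^sub>R L + \<nu> i"

definition fixed_points :: "complex set"
  where "fixed_points = {x. \<exists>i\<in>{1..N}. \<Psi> i x = x}"

definition V0 :: "complex set"
  where "V0 = {x \<in> fixed_points. \<exists>y\<in>fixed_points. y \<noteq> x \<and>
    (\<exists>i\<in>{1..N}. \<exists>j\<in>{1..N}. \<Psi> i \<noteq> \<Psi> j \<and> \<Psi> i x = \<Psi> j y)}"

definition k :: nat
  where "k = card V0"

definition V_minus1 :: "complex set"
  where "V_minus1 = (\<Union>i\<in>{1..N}. \<Psi> i ` V0)"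

definition edges_minus1 :: "(complex \<times> complex) set"
  where "edges_minus1 = {(x, y). x \<in> V_minus1 \<and> y \<in> V_minus1 \<and>
    (\<exists>i\<in>{1..N}. x \<in> \<Psi> i ` K \<and> y \<in> \<Psi> i ` K)}"

definition K_level :: "nat \<Rightarrow> complex set"
  where "K_level M = (\<lambda>x. L ^ M *\<^sub>R x) ` K"

definition K_infinity :: "complex set"
  where "K_infinity = (\<Union>M. K_level M)"

text \<open>For nonempty bounded \<open>K\<close> the set \<open>complex0 \<tau>\<close> determines \<open>\<tau>\<close>, so vertices and
  barycenter of a 0-complex can be given in terms of its translation vector.\<close>

definition complex0 :: "complex \<Rightarrow> complex set"
  where "complex0 \<tau> = (\<lambda>x. x + \<tau>) ` K"

definition shifts0 :: "complex set"
  where "shifts0 = {\<tau>. complex0 \<tau> \<subseteq> K_infinity \<and>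
    (\<exists>J \<iota>. 1 \<le> J \<and> (\<forall>j\<in>{1..J}. \<iota> j \<in> {1..N}) \<and> \<tau> = (\<Sum>j=1..J. L ^ j *\<^sub>R \<nu> (\<iota> j)))}"

definition vertices0 :: "complex \<Rightarrow> complex set"
  where "vertices0 \<tau> = (\<lambda>x. x + \<tau>) ` V0"

definition V0_infinity :: "complex set"
  where "V0_infinity = (\<Union>\<tau>\<in>shifts0. vertices0 \<tau>)"

definition vertices_K1 :: "complex set"
  where "vertices_K1 = (\<lambda>x. L *\<^sub>R x) ` V0"

definition rotations0 :: "(complex \<Rightarrow> complex) set"
  where "rotations0 = {R. (\<exists>t. R = (\<lambda>z. barycenter V0 + cis t * (z - barycenter V0))) \<and> R ` V0 = V0}"

definition GLP :: "'l set \<Rightarrow> bool"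
  where "GLP A \<longleftrightarrow> (\<exists>l :: complex \<Rightarrow> 'l. l \<in> V0_infinity \<rightarrow> A \<and> bij_betw l V0 A \<and>
    (\<forall>\<tau>\<in>shifts0. \<exists>R\<in>rotations0. \<forall>v\<in>vertices0 \<tau>. l v = l (R (v - \<tau>))))"

definition well_labelable :: "'l set \<Rightarrow> complex set set \<Rightarrow> bool"
  where "well_labelable A D \<longleftrightarrow> (\<exists>(l0 :: complex \<Rightarrow> 'l) (l :: complex \<Rightarrow> 'l).
    bij_betw l0 V0 A \<and>
    l \<in> (\<Union>\<tau>\<in>{\<tau> \<in> shifts0. complex0 \<tau> \<in> D}. vertices0 \<tau>) \<rightarrow> A \<and>
    (\<forall>\<tau>\<in>shifts0. complex0 \<tau> \<in> D \<longrightarrow>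
      (\<exists>R\<in>rotations0. \<forall>v\<in>vertices0 \<tau>. l v = l0 (R (v - \<tau>)))))"

text \<open>
  The vertices of \<open>\<K>\<^sup>\<langle>\<^sup>1\<^sup>\<rangle>\<close> form a regular \<open>k\<close>-gon, so the half-lines from its
  center \<open>b\<close> through them have the directions \<open>cis (2 * pi * m / k) * (w - b)\<close> for any one
  vertex \<open>w\<close>. The vertex \<open>w\<close> only fixes where the counter-clockwise numbering starts. Seen
  from \<open>b\<close>, the left bounding half-line of an angle is its counter-clockwise end, hence the
  interval of arguments is closed above. Periodicity of \<open>cis\<close> makes \<open>i\<close> an index modulo \<open>k\<close>.
\<close>

definition area :: "complex \<Rightarrow> nat \<Rightarrow> complex set"
  where "area w i = (let b = barycenter vertices_K1 in
    {b + r *\<^sub>R (cis t * (w - b)) | r t.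
      0 < r \<and> 2 * pi * (real i - 1) / real k < t \<and> t \<le> 2 * pi * real i / real k})"

definition slice :: "complex \<Rightarrow> nat \<Rightarrow> complex set set"
  where "slice w i = {complex0 \<tau> | \<tau>. \<tau> \<in> shifts0 \<and> complex0 \<tau> \<subseteq> K_level 1 \<and>
    barycenter (vertices0 \<tau>) \<in> area w i}"

end

text \<open>By Hutchinson's theorem, \<open>K\<close> is uniquely determined by being compact, nonempty and
  self-similar. The open set has to be nonempty, as the open set condition would
  otherwise be void. The bisector of \<open>[x, y]\<close> only exists for \<open>x \<noteq> y\<close>.\<close>

locale simple_nested_fractal = similitude_system +
  assumes L_gt_1: "1 < L"
    and zero_shift: "\<exists>i\<in>{1..N}. \<nu> i = 0"
    and compact_K: "compact K"
    and K_nonempty: "K \<noteq> {}"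
    and K_self_similar: "K = (\<Union>i\<in>{1..N}. \<Psi> i ` K)"
    and k_ge_2: "2 \<le> k"
    and open_set_condition: "\<exists>U. open U \<and> U \<noteq> {} \<and>
      (\<forall>i\<in>{1..N}. \<forall>j\<in>{1..N}. i \<noteq> j \<longrightarrow> \<Psi> i ` U \<inter> \<Psi> j ` U = {}) \<and>
      (\<Union>i\<in>{1..N}. \<Psi> i ` U) \<subseteq> U"
    and nesting: "\<lbrakk>i \<in> {1..N}; j \<in> {1..N}; i \<noteq> j\<rbrakk> \<Longrightarrow>
      \<Psi> i ` K \<inter> \<Psi> j ` K = \<Psi> i ` V0 \<inter> \<Psi> j ` V0"
    and symmetry: "\<lbrakk>i \<in> {1..N}; x \<in> V0; y \<in> V0; x \<noteq> y\<rbrakk> \<Longrightarrow>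
      \<exists>j\<in>{1..N}. bisector_reflection x y ` \<Psi> i ` V0 = \<Psi> j ` V0"
    and connectivity: "\<lbrakk>x \<in> V_minus1; y \<in> V_minus1\<rbrakk> \<Longrightarrow> (x, y) \<in> edges_minus1\<^sup>*"

end

theory Submission
  imports Defs
begin

text \<open>
  The reflections \<open>S\<^sub>x\<^sub>y\<close> permute the finite set \<open>V\<^sub>-\<^sub>1\<close>, so its barycenter is equidistant from the
  points of \<open>V\<^sub>0\<close>; the same reflections then show that \<open>V\<^sub>0\<close> is a regular \<open>k\<close>-gon. In suitable
  coordinates \<open>V\<^sub>0\<close> is the group of \<open>k\<close>-th roots of unity, the 0-complexes of \<open>\<K>\<^sup>\<langle>\<^sup>1\<^sup>\<rangle>\<close> are
  given by a finite set \<open>Z\<close> of centers invariant under the dihedral group, and a labeling assigns to each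
  \<open>z \<in> Z\<close> a root of unity \<open>u z\<close> such that common vertices \<open>z + p = z' + q\<close> satisfy
  \<open>u z * p = u z' * q\<close>.

  By nesting, two complexes share at most one vertex, and since \<open>\<K>\<^sup>\<langle>\<^sup>0\<^sup>\<rangle>\<close> is connected and cannot be
  cut at a vertex in such a way that vertices remain on both sides, no complex has vertices on both sides
  of a mirror of the dihedral group not passing through its center. Consequently two complexes which share
  a vertex and whose centers are strictly separated by a mirror are mirror images of each other. So
  every adjacency can be moved by the dihedral group into two adjacent slices, and a labeling of these
  extends to all complexes except possibly the one in the center, which can only have neighbors
  for \<open>k = 3, 4, 6\<close>.

  A labeling of \<open>\<K>\<^sup>\<langle>\<^sup>1\<^sup>\<rangle>\<close> spreads to \<open>\<K>\<^sup>\<langle>\<^sup>\<infinity>\<^sup>\<rangle>\<close>: the copy of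
  \<open>\<K>\<^sup>\<langle>\<^sup>M\<^sup>\<rangle>\<close> in place of \<open>z\<close> in \<open>\<K>\<^sup>\<langle>\<^sup>M\<^sup>+\<^sup>1\<^sup>\<rangle>\<close> receives the labels
  of \<open>\<K>\<^sup>\<langle>\<^sup>M\<^sup>\<rangle>\<close> rotated by \<open>u z\<close>.
\<close>

section \<open>Roots of unity and mirrors\<close>

definition rt :: "nat \<Rightarrow> int \<Rightarrow> complex"
  where "rt k j = cis (2 * pi * of_int j / of_nat k)"

lemma rt_0 [simp]: "rt k 0 = 1"
  by (simp add: rt_def)

lemma rt_add: "rt k (i + j) = rt k i * rt k j"
  by (simp add: rt_def cis_mult add_divide_distrib distrib_left)

lemma rt_minus: "rt k (- j) = cnj (rt k j)"
  by (simp add: rt_def cis_cnj)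

lemma rt_nonzero [simp]: "rt k j \<noteq> 0"
  by (simp add: rt_def)

lemma rt_minus_mult [simp]: "rt k (- j) * rt k j = 1" "rt k j * rt k (- j) = 1"
  by (simp_all flip: rt_add)

lemma rt_multiple:
  assumes "0 < k"
  shows "rt k (int k * t) = 1"
  using assms cis_multiple_2pi[of "of_int t"] by (simp add: rt_def mult_ac)

lemma rt_power:
  assumes "0 < k"
  shows "rt k j ^ k = 1"
proof -
  have "rt k j ^ k = cis (2 * pi * of_int j)"
    using assms unfolding rt_def Complex.DeMoivre by (simp add: mult.commute)
  then show ?thesis
    using cis_multiple_2pi[of "of_int j"] by simp
qed

lemma rt_cnj [simp]: "rt k j * cnj (rt k j) = 1"
  by (simp flip: rt_minus)

lemma rt_cnj_cancel [simp]: "rt k j * (cnj (rt k j) * y) = y"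
  by (simp flip: mult.assoc)

lemma rt_mult_cnj: "rt k i * cnj (rt k j) = rt k (i - j)"
  by (simp flip: rt_minus rt_add)

lemma root_of_unity_rt:
  assumes "0 < k" "p ^ k = 1"
  obtains j where "0 \<le> j" "j < int k" "p = rt k j"
proof -
  have "p \<in> (\<lambda>j. cis (2 * pi * real j / real k)) ` {..<k}"
    using bij_betw_imp_surj_on[OF Complex.bij_betw_roots_unity[OF assms(1)]] assms(2) by simp
  then obtain j where "j < k" "p = cis (2 * pi * real j / real k)"
    by blast
  then show thesis
    by (intro that[of "int j"]) (auto simp: rt_def)
qed

lemma norm_root_of_unity:
  fixes p :: complex
  assumes "0 < k" "p ^ k = 1"
  shows "norm p = 1"
  using power_eq_1_iff[OF assms(2)] assms(1) by simp

lemma cnj_unit: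
  assumes "norm p = 1"
  shows "cnj p = 1 / p"
proof -
  have "p * cnj p = 1"
    using assms by (simp add: complex_norm_square[symmetric])
  moreover have "p \<noteq> 0"
    using assms by auto
  ultimately show ?thesis
    by (simp add: field_simps)
qed

lemma power_int_root_of_unity:
  fixes p :: complex
  assumes "p ^ k = 1"
  shows "(p powi j) ^ k = 1" "p powi (int k * t) = 1"
proof -
  show *: "p powi (int k * t) = 1" for t
    using assms by (simp only: power_int_mult power_int_of_nat power_int_1_left)
  have "(p powi j) ^ k = p powi (int k * j)"
    by (simp only: mult.commute[of "int k"] power_int_mult power_int_of_nat)
  then show "(p powi j) ^ k = 1"
    using * by simp
qed

text \<open>The cell with center \<open>z\<close> carries the label \<open>u z * p\<close> at its vertex \<open>z + p\<close>, so \<open>u z\<close> is the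
  rotation \<open>R\<close> of this cell.\<close>

definition well_labels :: "nat \<Rightarrow> complex set \<Rightarrow> (complex \<Rightarrow> complex) \<Rightarrow> bool"
  where "well_labels k S u \<longleftrightarrow> (\<forall>z\<in>S. u z ^ k = 1) \<and>
    (\<forall>z\<in>S. \<forall>z'\<in>S. \<forall>p q. p ^ k = 1 \<longrightarrow> q ^ k = 1 \<longrightarrow> z + p = z' + q \<longrightarrow> u z * p = u z' * q)"

lemma well_labelsD:
  assumes "well_labels k S u" "z \<in> S"
  shows "u z ^ k = 1"
    and "\<lbrakk>z' \<in> S; p ^ k = 1; q ^ k = 1; z + p = z' + q\<rbrakk> \<Longrightarrow> u z * p = u z' * q"
  using assms unfolding well_labels_def by blast+

text \<open>The closed sectors between consecutive mirrors, without their apex; each is a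
  fundamental domain of the dihedral group of order \<open>2 * k\<close>. The index runs over all
  integers, so indices differing by \<open>2 * k\<close> name the same chamber.\<close>

definition chamber :: "nat \<Rightarrow> int \<Rightarrow> complex set"
  where "chamber k n = {rcis r \<phi> | r \<phi>. 0 < r \<and>
    pi * of_int n / of_nat k \<le> \<phi> \<and> \<phi> \<le> pi * (of_int n + 1) / of_nat k}"

text \<open>The imaginary part of \<open>cnj (mirror_dir k c) * y\<close> is the signed distance of
  \<open>y\<close> from the mirror in this direction, and the reflection in the mirror takes
  \<open>y\<close> to \<open>rt k c * cnj y\<close>.\<close>

definition mirror_dir :: "nat \<Rightarrow> int \<Rightarrow> complex"
  where "mirror_dir k c = cis (pi * of_int c / of_nat k)"

lemma mirror_dir_square: "mirror_dir k c * mirror_dir k c = rt k c"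
  by (simp add: cis_mult rt_def mirror_dir_def mult.assoc)

lemma mirror_dir_mirror: "cnj (mirror_dir k c) * rt k c = mirror_dir k c"
  by (simp add: rt_def mirror_dir_def cis_cnj cis_mult diff_divide_distrib[symmetric])

lemma mirror_dir_cnj [simp]: "cnj (mirror_dir k c) * mirror_dir k c = 1" "mirror_dir k c * cnj (mirror_dir k c) = 1"
  by (simp_all add: mirror_dir_def cis_cnj cis_mult)

lemma Im_mirror: "Im (cnj (mirror_dir k c) * (rt k c * cnj y)) = - Im (cnj (mirror_dir k c) * y)"
proof -
  have "cnj (mirror_dir k c) * (rt k c * cnj y) = cnj (cnj (mirror_dir k c) * y)"
    unfolding mult.assoc[symmetric] mirror_dir_mirror by simp
  then show ?thesis
    by (simp only: cnj.sel(2))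
qed

lemma mirror_fixed:
  assumes "Im (cnj (mirror_dir k c) * y) = 0"
  shows "rt k c * cnj y = y"
proof -
  define e where "e = mirror_dir k c"
  have "cnj (cnj e * y) = cnj e * y"
    using assms unfolding e_def by (simp add: complex_eq_iff)
  then have "e * (e * cnj y) = e * (cnj e * y)"
    by simp
  then show ?thesis
    unfolding mult.assoc[symmetric] by (simp add: e_def mirror_dir_square)
qed

text \<open>Isolates the geometry on which the labeling argument rests. The cell with center
  \<open>z\<close> has the vertices \<open>z + p\<close> with \<open>p ^ k = 1\<close>; the last two
  assumptions are where nesting and connectedness of the fractal enter.\<close>

locale polygon_cells =
  fixes k :: nat and Z :: "complex set"
  assumes k_ge_3: "3 \<le> k"
    and rotate: "\<lbrakk>z \<in> Z; p ^ k = 1\<rbrakk> \<Longrightarrow> p * z \<in> Z"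
    and cnj_closed: "z \<in> Z \<Longrightarrow> cnj z \<in> Z"
    and share_unique: "\<lbrakk>z \<in> Z; z' \<in> Z; z \<noteq> z'; p ^ k = 1; q ^ k = 1; p' ^ k = 1; q' ^ k = 1;
      z + p = z' + q; z + p' = z' + q'\<rbrakk> \<Longrightarrow> p = p'"
    and same_side: "\<lbrakk>z \<in> Z; p ^ k = 1; Im (cnj (mirror_dir k c) * z) > 0\<rbrakk>
      \<Longrightarrow> Im (cnj (mirror_dir k c) * (z + p)) \<ge> 0"
begin

lemma k_pos: "0 < k"
  using k_ge_3 by simp

lemma mirror_closed: "z \<in> Z \<Longrightarrow> rt k c * cnj z \<in> Z"
  using rotate cnj_closed rt_power k_pos by blast

lemma same_side_neg:
  assumes "z \<in> Z" "p ^ k = 1" "Im (cnj (mirror_dir k c) * z) < 0"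
  shows "Im (cnj (mirror_dir k c) * (z + p)) \<le> 0"
proof -
  \<comment> \<open>Raising the index by \<open>k\<close> gives the same mirror with its sides
    exchanged.\<close>
  have "mirror_dir k (c + int k) = - mirror_dir k c"
    using k_pos by (simp add: mirror_dir_def minus_cis add_divide_distrib distrib_left)
  then show ?thesis
    using same_side[OF assms(1,2), of "c + int k"] assms(3) by simp
qed

text \<open>Both cells stay weakly on their own sides, so the common vertex lies on the mirror and
  is also a vertex of the reflection of \<open>z'\<close>, which is on the side of \<open>z\<close>.
  The claim is that this reflection is \<open>z\<close> itself.\<close>

lemma mirror_image:
  assumes z: "z \<in> Z" "z' \<in> Z" and pq: "p ^ k = 1" "q ^ k = 1" "z + p = z' + q"
    and opp: "Im (cnj (mirror_dir k c) * z) < 0"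
      "Im (cnj (mirror_dir k c) * z') > 0"
  shows "z' = rt k c * cnj z"
proof (rule ccontr)
  define f where "f y = Im (cnj (mirror_dir k c) * y)" for y
  define s where "s y = rt k c * cnj y" for y
  have f_add: "f (x + y) = f x + f y" for x y
    by (simp add: f_def distrib_left)
  have s_add: "s (x + y) = s x + s y" for x y
    by (simp add: s_def distrib_left)
  have ss: "s (s x) = x" for x
    by (simp add: s_def)
  have s_root: "s x ^ k = 1" if "x ^ k = 1" for x
    using that rt_power[OF k_pos] by (simp add: s_def power_mult_distrib flip: complex_cnj_power)
  have fs: "f (s y) = - f y" for y
    unfolding f_def s_def by (rule Im_mirror)
  have fixd: "s y = y" if "f y = 0" for y
    using that unfolding f_def s_def by (rule mirror_fixed)
  have sz: "s z \<in> Z" "s z' \<in> Z"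
    using z mirror_closed by (auto simp: s_def)
  have opp': "f z < 0" "f z' > 0"
    using opp by (simp_all add: f_def)
  have below: "f (z + x) \<le> 0" if "x ^ k = 1" for x
    using same_side_neg[OF z(1) that opp(1)] by (simp add: f_def)
  have below': "f (s z' + x) \<le> 0" if "x ^ k = 1" for x
    using same_side_neg[OF sz(2) that, of c] opp' fs[of z'] by (simp add: f_def)
  have v0: "f (z + p) = 0"
    using below[OF pq(1)] same_side[OF z(2) pq(2) opp(2)] pq(3) by (simp add: f_def)
  have sv: "s z' + s q = z + p"
    using fixd[OF v0] unfolding s_add[symmetric] pq(3)[symmetric] .
  \<comment> \<open>Exchanging the directions \<open>p\<close> and \<open>s q\<close> between
    \<open>z\<close> and \<open>s z'\<close> keeps the sum of the heights, which is 0. As neither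
    height is positive, both vanish.\<close>
  have "f (z + s q) \<le> 0" "f (s z' + p) \<le> 0"
    using below below' s_root pq by auto
  moreover have "f (s z' + s q) = 0"
    using v0 sv by simp
  ultimately have "f (z + s q) = 0"
    using v0 by (simp add: f_add)
  then have "s (z + s q) = z + s q" "s (z + p) = z + p"
    using fixd v0 by auto
  \<comment> \<open>A vertex of \<open>z\<close> on the mirror is also a vertex of
    \<open>s z\<close>. So \<open>z\<close> and \<open>s z\<close> share two vertices, which must
    coincide.\<close>
  then have shared: "z + s q = s z + q" "z + p = s z + s p"
    by (simp_all only: s_add ss)
  have "z \<noteq> s z"
    using fs[of z] opp' by auto
  then have "p = s q"
    using share_unique[OF z(1) sz(1) _ pq(1) s_root[OF pq(1)] s_root[OF pq(2)] pq(2) shared(2,1)] by simp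
  then have "s z' = z"
    using sv by simp
  then have "s z = z'"
    using ss by metis
  moreover assume "z' \<noteq> rt k c * cnj z"
  ultimately show False
    by (simp add: s_def)
qed

end

section \<open>Chambers under rotations and reflections\<close>

lemma rt_times_rcis: "rt k j * rcis r \<phi> = rcis r (\<phi> + 2 * pi * of_int j / of_nat k)"
  by (simp add: rt_def rcis_def cis_mult mult_ac add_ac)

lemma chamberI:
  assumes "y = rcis r \<phi>" "0 < r" "pi * of_int n / of_nat k \<le> \<phi>" "\<phi> \<le> pi * (of_int n + 1) / of_nat k"
  shows "y \<in> chamber k n"
  using assms by (auto simp: chamber_def)

lemma chamberE:
  assumes "y \<in> chamber k n"
  obtains r \<phi> where "y = rcis r \<phi>" "0 < r"
    "pi * of_int n / of_nat k \<le> \<phi>" "\<phi> \<le> pi * (of_int n + 1) / of_nat k"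
  using assms by (auto simp: chamber_def)

lemma chamber_rotate:
  assumes "y \<in> chamber k n"
  shows "rt k j * y \<in> chamber k (n + 2 * j)"
proof -
  from assms obtain r \<phi> where y: "y = rcis r \<phi>" "0 < r"
    "pi * of_int n / of_nat k \<le> \<phi>" "\<phi> \<le> pi * (of_int n + 1) / of_nat k"
    by (rule chamberE)
  have "rt k j * y = rcis r (\<phi> + 2 * pi * of_int j / of_nat k)"
    by (simp add: y(1) rt_times_rcis)
  moreover have "pi * of_int (n + 2 * j) / of_nat k = pi * of_int n / of_nat k + 2 * pi * of_int j / of_nat k"
    "pi * (of_int (n + 2 * j) + 1) / of_nat k = pi * (of_int n + 1) / of_nat k + 2 * pi * of_int j / of_nat k"
    by (simp_all add: add_divide_distrib distrib_left)
  ultimately show ?thesis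
    using y by (intro chamberI[of _ r "\<phi> + 2 * pi * of_int j / of_nat k"]) auto
qed

lemma chamber_cnj:
  assumes "y \<in> chamber k n"
  shows "cnj y \<in> chamber k (- n - 1)"
proof -
  from assms obtain r \<phi> where y: "y = rcis r \<phi>" "0 < r"
    "pi * of_int n / of_nat k \<le> \<phi>" "\<phi> \<le> pi * (of_int n + 1) / of_nat k"
    by (rule chamberE)
  have "cnj y = rcis r (- \<phi>)"
    by (simp add: y(1) rcis_def cis_cnj)
  moreover have "pi * of_int (- n - 1) / of_nat k = - (pi * (of_int n + 1) / of_nat k)"
    "pi * (of_int (- n - 1) + 1) / of_nat k = - (pi * of_int n / of_nat k)"
    by (simp_all only: minus_divide_left) (simp_all add: algebra_simps)
  ultimately show ?thesis
    using y by (intro chamberI[of _ r "- \<phi>"]) auto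
qed

lemma chamber_mirror:
  assumes "y \<in> chamber k n"
  shows "rt k (n + 1) * cnj y \<in> chamber k (n + 1)"
  using chamber_rotate[OF chamber_cnj[OF assms], of "n + 1"] by simp

lemma floor_angle:
  fixes \<phi> :: real
  assumes "0 < k"
  defines "n \<equiv> \<lfloor>\<phi> * of_nat k / pi\<rfloor>"
  shows "pi * of_int n / of_nat k \<le> \<phi>" "\<phi> < pi * (of_int n + 1) / of_nat k"
proof -
  have "of_int n \<le> \<phi> * of_nat k / pi" "\<phi> * of_nat k / pi < of_int n + 1"
    unfolding n_def using floor_correct by auto
  then show "pi * of_int n / of_nat k \<le> \<phi>" "\<phi> < pi * (of_int n + 1) / of_nat k"
    using assms(1) by (simp_all add: field_simps)
qed

lemma rcis_in_chamber:
  assumes "0 < k" "0 < r"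
  shows "rcis r \<phi> \<in> chamber k \<lfloor>\<phi> * of_nat k / pi\<rfloor>"
  using assms floor_angle[of k \<phi>] by (intro chamberI[of _ r \<phi>]) auto

lemma rcis_eq_imp_angle:
  assumes "rcis r \<phi> = rcis r' \<phi>'" "0 < r" "0 < r'"
  obtains t :: int where "\<phi>' = \<phi> + 2 * pi * of_int t"
proof -
  have "r = r'"
    using assms by (metis abs_of_pos complex_mod_rcis)
  then have "cis \<phi>' = cis \<phi>"
    using assms by (simp add: rcis_def)
  then have "cis (\<phi>' - \<phi>) = 1"
    by (simp flip: cis_divide)
  then have "cos (\<phi>' - \<phi>) = 1"
    by (metis cis.sel(1) one_complex.sel(1))
  then obtain t :: int where "\<phi>' - \<phi> = of_int t * 2 * pi"
    by (auto simp: cos_one_2pi_int)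
  then show thesis
    by (intro that[of t]) (auto simp: algebra_simps)
qed

text \<open>Two arguments of \<open>y\<close> differ by \<open>2 * pi * t\<close>, which is
  \<open>2 * k * t\<close> chambers. Up to this shift the chambers are equal or adjacent, since
  closed sectors overlap only along walls.\<close>

lemma chamber_overlap:
  assumes "0 < k" "y \<in> chamber k n" "y \<in> chamber k n'"
  obtains t where "n' + 2 * (int k * t) \<in> {n - 1, n, n + 1}"
proof -
  from assms(2) obtain r \<phi> where y: "y = rcis r \<phi>" "0 < r"
    "pi * of_int n / of_nat k \<le> \<phi>" "\<phi> \<le> pi * (of_int n + 1) / of_nat k"
    by (rule chamberE)
  from assms(3) obtain r' \<phi>' where y': "y = rcis r' \<phi>'" "0 < r'"
    "pi * of_int n' / of_nat k \<le> \<phi>'" "\<phi>' \<le> pi * (of_int n' + 1) / of_nat k"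
    by (rule chamberE)
  obtain t :: int where t: "\<phi> = \<phi>' + 2 * pi * of_int t"
    using rcis_eq_imp_angle[of r' \<phi>' r \<phi>] y y' by metis
  have "pi * real_of_int n \<le> pi * (real_of_int n' + 1 + 2 * real k * of_int t)"
    "pi * (real_of_int n' + 2 * real k * of_int t) \<le> pi * (real_of_int n + 1)"
    using y(3,4) y'(3,4) t assms(1) by (simp_all add: field_simps)
  then have "real_of_int n \<le> real_of_int (n' + 1 + 2 * (int k * t))"
    "real_of_int (n' + 2 * (int k * t)) \<le> real_of_int (n + 1)"
    by (simp_all add: mult_le_cancel_left_pos)
  then have "n' + 2 * (int k * t) \<in> {n - 1, n, n + 1}"
    unfolding of_int_le_iff by auto
  then show thesis
    by (rule that)
qed

lemma Im_mirror_dir_rcis: "Im (cnj (mirror_dir k c) * rcis r \<phi>) = r * sin (\<phi> - pi * of_int c / of_nat k)"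
proof -
  have "cnj (mirror_dir k c) * rcis r \<phi> = rcis r (\<phi> - pi * of_int c / of_nat k)"
    by (simp add: mirror_dir_def rcis_def cis_cnj cis_mult mult_ac)
  then show ?thesis
    by simp
qed

context polygon_cells
begin

text \<open>The angle between \<open>y\<close> and either wall lies between 0 and
  \<open>pi / k\<close>, so its sine is nonnegative.\<close>

lemma chamber_sides:
  assumes "y \<in> chamber k n"
  shows "0 \<le> Im (cnj (mirror_dir k n) * y)" "Im (cnj (mirror_dir k (n + 1)) * y) \<le> 0"
proof -
  from assms obtain r \<phi> where y: "y = rcis r \<phi>" "0 < r"
    "pi * of_int n / of_nat k \<le> \<phi>" "\<phi> \<le> pi * (of_int n + 1) / of_nat k"
    by (rule chamberE)
  have "pi / of_nat k \<le> pi"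
    using k_pos by (simp add: field_simps)
  moreover have *: "pi * of_int (n + 1) / of_nat k = pi * of_int n / of_nat k + pi / of_nat k"
    by (simp add: distrib_left add_divide_distrib)
  ultimately have "0 \<le> sin (\<phi> - pi * of_int n / of_nat k)"
    "0 \<le> sin (pi * of_int (n + 1) / of_nat k - \<phi>)"
    using y(3,4) by (intro sin_ge_zero; simp)+
  moreover have "sin (\<phi> - pi * of_int (n + 1) / of_nat k) = - sin (pi * of_int (n + 1) / of_nat k - \<phi>)"
    by (simp flip: sin_minus)
  ultimately show "0 \<le> Im (cnj (mirror_dir k n) * y)" "Im (cnj (mirror_dir k (n + 1)) * y) \<le> 0"
    unfolding y(1) Im_mirror_dir_rcis using y(2) by simp_all
qed

lemma chamber_wall:
  assumes "y \<in> chamber k n" "y \<in> chamber k (n + 1)"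
  shows "rt k (n + 1) * cnj y = y"
  using chamber_sides(2)[OF assms(1)] chamber_sides(1)[OF assms(2)] by (intro mirror_fixed) simp

end

text \<open>A labeling \<open>u\<close> of the cells in the fundamental chamber is extended by giving the mirror images of
  \<open>z\<close> in the two walls the labels \<open>\<gamma> z / u z\<close> and \<open>\<delta> z / u z\<close>, hence the rotated cell
  \<open>rt k j * z\<close> the label \<open>u z * (\<delta> z / \<gamma> z) powi j\<close>. As reflections invert the labels, \<open>\<gamma>\<close> and \<open>\<delta>\<close>
  have to be constant along adjacencies.\<close>

locale folded_labels = polygon_cells +
  fixes u \<gamma> \<delta> :: "complex \<Rightarrow> complex"
  assumes units: "z \<in> Z \<Longrightarrow> z \<in> chamber k 0 \<Longrightarrow> u z ^ k = 1"
      "z \<in> Z \<Longrightarrow> z \<in> chamber k 0 \<Longrightarrow> \<gamma> z ^ k = 1"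
      "z \<in> Z \<Longrightarrow> z \<in> chamber k 0 \<Longrightarrow> \<delta> z ^ k = 1"
    and inside: "\<lbrakk>z \<in> Z; z \<in> chamber k 0; z' \<in> Z; z' \<in> chamber k 0; p ^ k = 1; q ^ k = 1; z + p = z' + q\<rbrakk>
      \<Longrightarrow> u z * p = u z' * q \<and> \<gamma> z = \<gamma> z' \<and> \<delta> z = \<delta> z'"
    and wall0: "\<lbrakk>z \<in> Z; z \<in> chamber k 0; p ^ k = 1; q ^ k = 1; z + p = cnj z + q\<rbrakk>
      \<Longrightarrow> u z * p = \<gamma> z / u z * q"
    and wall1: "\<lbrakk>z \<in> Z; z \<in> chamber k 0; p ^ k = 1; q ^ k = 1; z + p = rt k 1 * cnj z + q\<rbrakk>
      \<Longrightarrow> u z * p = \<delta> z / u z * q"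
begin

text \<open>Chamber \<open>2 * j\<close> consists of the points \<open>rt k j * z\<close> and
  chamber \<open>2 * j - 1\<close> of the points \<open>rt k j * cnj z\<close>, with
  \<open>z\<close> in chamber 0; \<open>(n + 1) div 2\<close> recovers \<open>j\<close> in both
  cases.\<close>

definition on_chamber :: "int \<Rightarrow> complex \<Rightarrow> complex"
  where "on_chamber n y = (let j = (n + 1) div 2; z = rt k (- j) * y in
    if even n then u z * (\<delta> z / \<gamma> z) powi j
    else \<gamma> (cnj z) / u (cnj z) * (\<delta> (cnj z) / \<gamma> (cnj z)) powi j)"

lemma on_chamber_even: "on_chamber (2 * j) (rt k j * z) = u z * (\<delta> z / \<gamma> z) powi j"
  by (simp add: on_chamber_def flip: mult.assoc)

lemma on_chamber_odd: "on_chamber (2 * j - 1) (rt k j * cnj z) = \<gamma> z / u z * (\<delta> z / \<gamma> z) powi j"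
  by (simp add: on_chamber_def Let_def rt_minus flip: mult.assoc)

lemma nonzero:
  assumes "z \<in> Z" "z \<in> chamber k 0"
  shows "u z \<noteq> 0" "\<gamma> z \<noteq> 0" "\<delta> z \<noteq> 0"
  using units[OF assms] k_pos by (auto simp: power_0_left)

lemma chamber_cases:
  assumes "y \<in> Z" "y \<in> chamber k n"
  obtains (even) j z where "n = 2 * j" "y = rt k j * z" "z \<in> Z" "z \<in> chamber k 0"
    | (odd) j z where "n = 2 * j - 1" "y = rt k j * cnj z" "z \<in> Z" "z \<in> chamber k 0"
proof (cases "even n")
  case True
  then obtain j where n: "n = 2 * j"
    by (rule evenE)
  have "rt k (- j) * y \<in> Z" "rt k (- j) * y \<in> chamber k 0"
    using rotate[OF assms(1) rt_power[OF k_pos]] chamber_rotate[OF assms(2), of "- j"] n by auto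
  then show thesis
    using n by (intro even[of j "rt k (- j) * y"]) (auto simp flip: mult.assoc)
next
  case False
  then obtain j' where "n = 2 * j' + 1"
    by (rule oddE)
  then obtain j where n: "n = 2 * j - 1"
    by (metis add_diff_cancel_right' distrib_left mult.right_neutral one_add_one diff_add_eq diff_diff_eq2 is_num_normalize(1))
  have "cnj (rt k (- j) * y) \<in> Z" "cnj (rt k (- j) * y) \<in> chamber k 0"
    using cnj_closed[OF rotate[OF assms(1) rt_power[OF k_pos]]]
      chamber_cnj[OF chamber_rotate[OF assms(2), of "- j"]] n by auto
  then show thesis
    using n by (intro odd[of j "cnj (rt k (- j) * y)"]) (auto simp: rt_minus simp flip: mult.assoc)
qed

text \<open>A center on the common wall is its own mirror image. The wall condition with
  \<open>p = q = 1\<close> then says that the label of the cell equals that of its mirror image, so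
  the two formulas agree.\<close>

lemma on_chamber_Suc:
  assumes "y \<in> Z" "y \<in> chamber k n" "y \<in> chamber k (n + 1)"
  shows "on_chamber (n + 1) y = on_chamber n y"
proof -
  note wall = chamber_wall[OF assms(2,3)]
  from assms(1,2) show ?thesis
  proof (cases rule: chamber_cases)
    case (even j z)
    have "rt k j * (rt k 1 * cnj z) = rt k (n + 1) * cnj y"
      unfolding even(1,2) complex_cnj_mult mult.assoc[symmetric] rt_mult_cnj rt_add[symmetric]
      by simp
    then have "rt k j * (rt k 1 * cnj z) = rt k j * z"
      by (simp only: wall) (simp only: even(2))
    then have fixed: "rt k 1 * cnj z = z"
      by (simp only: mult_cancel_left rt_nonzero simp_thms)
    then have y: "y = rt k (j + 1) * cnj z"
      using even by (simp add: rt_add mult.assoc)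
    have "u z = \<delta> z / u z"
      using wall1[OF even(3,4), of 1 1] fixed by simp
    moreover have "\<gamma> z / u z * (\<delta> z / \<gamma> z) powi (j + 1) = \<delta> z / u z * (\<delta> z / \<gamma> z) powi j"
      using nonzero[OF even(3,4)] by (simp add: power_int_add)
    ultimately have "on_chamber (2 * (j + 1) - 1) y = u z * (\<delta> z / \<gamma> z) powi j"
      unfolding y on_chamber_odd by simp
    moreover have "2 * (j + 1) - 1 = n + 1"
      using even(1) by simp
    ultimately show ?thesis
      using on_chamber_even[of j z] even(1,2) by metis
  next
    case (odd j z)
    have "rt k j * z = rt k (n + 1) * cnj y"
      unfolding odd(1,2) complex_cnj_mult mult.assoc[symmetric] rt_mult_cnj by simp
    then have "rt k j * z = rt k j * cnj z"
      by (simp only: wall) (simp only: odd(2))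
    then have fixed: "cnj z = z"
      by simp
    have "u z = \<gamma> z / u z"
      using wall0[OF odd(3,4), of 1 1] fixed by simp
    then show ?thesis
      using on_chamber_even[of j z] on_chamber_odd[of j z] odd(1,2) fixed by simp
  qed
qed

text \<open>The factor gained by one rotation step is a \<open>k\<close>-th root of unity, so a full
  turn changes nothing.\<close>

lemma on_chamber_period:
  assumes "y \<in> Z" "y \<in> chamber k n"
  shows "on_chamber (n + 2 * (int k * t)) y = on_chamber n y"
  using assms
proof (cases rule: chamber_cases)
  case (even j z)
  have "(\<delta> z / \<gamma> z) ^ k = 1"
    using units[OF even(3,4)] by (simp add: power_divide)
  moreover have "y = rt k (j + int k * t) * z"
    using even by (simp add: rt_add rt_multiple k_pos)
  ultimately have "on_chamber (2 * (j + int k * t)) y = u z * (\<delta> z / \<gamma> z) powi j"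
    using on_chamber_even[of "j + int k * t" z] nonzero[OF even(3,4)]
    by (simp add: power_int_add power_int_root_of_unity)
  then show ?thesis
    using on_chamber_even[of j z] even(1,2) by (simp add: algebra_simps)
next
  case (odd j z)
  have "(\<delta> z / \<gamma> z) ^ k = 1"
    using units[OF odd(3,4)] by (simp add: power_divide)
  moreover have "y = rt k (j + int k * t) * cnj z"
    using odd by (simp add: rt_add rt_multiple k_pos)
  ultimately have "on_chamber (2 * (j + int k * t) - 1) y = \<gamma> z / u z * (\<delta> z / \<gamma> z) powi j"
    using on_chamber_odd[of "j + int k * t" z] nonzero[OF odd(3,4)]
    by (simp add: power_int_add power_int_root_of_unity)
  moreover have "2 * (j + int k * t) - 1 = n + 2 * (int k * t)"
    using odd(1) by simp
  ultimately show ?thesis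
    using on_chamber_odd[of j z] odd(1,2) by metis
qed

lemma on_chamber_eq:
  assumes "y \<in> Z" "y \<in> chamber k n" "y \<in> chamber k n'"
  shows "on_chamber n y = on_chamber n' y"
proof -
  obtain t where t: "n' + 2 * (int k * t) \<in> {n - 1, n, n + 1}"
    using chamber_overlap[OF k_pos assms(2,3)] by blast
  have "y \<in> chamber k (n' + 2 * (int k * t))"
    using chamber_rotate[OF assms(3), of "int k * t"] by (simp add: rt_multiple k_pos)
  then have "on_chamber (n' + 2 * (int k * t)) y = on_chamber n y"
    using t on_chamber_Suc[OF assms(1), of n] on_chamber_Suc[OF assms(1), of "n - 1"] assms(2) by auto
  then show ?thesis
    using on_chamber_period[OF assms(1,3), of t] by simp
qed

text \<open>The choice of the chamber is immaterial by \<open>on_chamber_eq\<close>. The point 0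
  lies in no chamber; the center cell gets its label separately.\<close>

definition label :: "complex \<Rightarrow> complex"
  where "label y = on_chamber (SOME n. y \<in> chamber k n) y"

lemma label_eq:
  assumes "y \<in> Z" "y \<in> chamber k n"
  shows "label y = on_chamber n y"
  unfolding label_def using assms by (intro on_chamber_eq) (auto intro: someI)

lemma label_rotate:
  assumes "z \<in> Z" "z \<in> chamber k 0"
  shows "label (rt k j * z) = u z * (\<delta> z / \<gamma> z) powi j"
    and "label (rt k j * cnj z) = \<gamma> z / u z * (\<delta> z / \<gamma> z) powi j"
proof -
  have "rt k j * z \<in> Z" "rt k j * cnj z \<in> Z"
    using assms rotate rt_power k_pos cnj_closed by auto
  moreover have "rt k j * z \<in> chamber k (2 * j)" "rt k j * cnj z \<in> chamber k (2 * j - 1)"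
    using chamber_rotate[OF assms(2), of j] chamber_rotate[OF chamber_cnj[OF assms(2)], of j] by simp_all
  ultimately show "label (rt k j * z) = u z * (\<delta> z / \<gamma> z) powi j"
    "label (rt k j * cnj z) = \<gamma> z / u z * (\<delta> z / \<gamma> z) powi j"
    by (simp_all add: label_eq on_chamber_even on_chamber_odd)
qed

text \<open>The adjacency is carried back to chamber 0, where \<open>inside\<close> applies. For odd
  chambers this reverses the orientation and conjugates \<open>p\<close> and
  \<open>q\<close>.\<close>

lemma label_edge_same_chamber:
  assumes "y \<in> Z" "y' \<in> Z" "y \<in> chamber k n" "y' \<in> chamber k n"
    and "p ^ k = 1" "q ^ k = 1" "y + p = y' + q"
  shows "label y * p = label y' * q"
  using assms(1,3)
proof (cases rule: chamber_cases)
  case (even j z)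
  from assms(2,4) obtain z' where z': "y' = rt k j * z'" "z' \<in> Z" "z' \<in> chamber k 0"
    using even(1) by (cases rule: chamber_cases) (auto, presburger)
  have roots: "(rt k (- j) * p) ^ k = 1" "(rt k (- j) * q) ^ k = 1"
    using assms(5,6) rt_power[OF k_pos] by (simp_all add: power_mult_distrib)
  have "rt k (- j) * (y + p) = rt k (- j) * (y' + q)"
    using assms(7) by simp
  then have "z + rt k (- j) * p = z' + rt k (- j) * q"
    by (simp add: even(2) z'(1) distrib_left flip: mult.assoc)
  from inside[OF even(3,4) z'(2,3) roots this]
  have *: "u z * p = u z' * q" "\<gamma> z = \<gamma> z'" "\<delta> z = \<delta> z'"
    by auto
  have "label y * p = (u z * p) * (\<delta> z / \<gamma> z) powi j" "label y' * q = (u z' * q) * (\<delta> z / \<gamma> z) powi j"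
    by (simp_all add: *(2,3) label_rotate(1)[OF even(3,4)] label_rotate(1)[OF z'(2,3)] even(2) z'(1))
  then show ?thesis
    using *(1) by (simp only:)
next
  case (odd j z)
  from assms(2,4) obtain z' where z': "y' = rt k j * cnj z'" "z' \<in> Z" "z' \<in> chamber k 0"
    using odd(1) by (cases rule: chamber_cases) (auto, presburger)
  have roots: "(rt k j * cnj p) ^ k = 1" "(rt k j * cnj q) ^ k = 1"
    using assms(5,6) rt_power[OF k_pos] by (simp_all add: power_mult_distrib flip: complex_cnj_power)
  have "rt k j * cnj (y + p) = rt k j * cnj (y' + q)"
    using assms(7) by simp
  then have "z + rt k j * cnj p = z' + rt k j * cnj q"
    by (simp add: odd(2) z'(1) distrib_left)
  from inside[OF odd(3,4) z'(2,3) roots this]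
  have *: "u z * cnj p = u z' * cnj q" "\<gamma> z = \<gamma> z'" "\<delta> z = \<delta> z'"
    by auto
  have "p \<noteq> 0" "q \<noteq> 0" "norm p = 1" "norm q = 1"
    using norm_root_of_unity[OF k_pos] assms(5,6) by force+
  \<comment> \<open>For roots of unity \<open>cnj p\<close> is \<open>1 / p\<close>; inverting the
    equation matches the labels \<open>\<gamma> z / u z\<close> of mirror images.\<close>
  then have "p / u z = q / u z'"
    using *(1) nonzero[OF odd(3,4)] nonzero[OF z'(2,3)] by (simp add: cnj_unit field_simps)
  moreover have "label y * p = \<gamma> z * (p / u z) * (\<delta> z / \<gamma> z) powi j"
    "label y' * q = \<gamma> z' * (q / u z') * (\<delta> z' / \<gamma> z') powi j"
    by (simp_all add: label_rotate(2)[OF odd(3,4)] label_rotate(2)[OF z'(2,3)] odd(2) z'(1))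
  ultimately show ?thesis
    using * by simp
qed

text \<open>For even \<open>n\<close> the wall between the two cells is an image of wall 1 of
  chamber 0, for odd \<open>n\<close> an image of wall 0 with the roles of the cells
  exchanged.\<close>

lemma label_edge_mirror:
  assumes "y \<in> Z" "y \<in> chamber k n" "y' = rt k (n + 1) * cnj y"
    and "p ^ k = 1" "q ^ k = 1" "y + p = y' + q"
  shows "label y * p = label y' * q"
  using assms(1,2)
proof (cases rule: chamber_cases)
  case (even j z)
  have y': "y' = rt k (j + 1) * cnj z"
    unfolding assms(3) even(1,2) complex_cnj_mult mult.assoc[symmetric] rt_mult_cnj by simp
  have roots: "(rt k (- j) * p) ^ k = 1" "(rt k (- j) * q) ^ k = 1"
    using assms(4,5) rt_power[OF k_pos] by (simp_all add: power_mult_distrib)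
  have "rt k (- j) * (y + p) = rt k (- j) * (y' + q)"
    using assms(6) by simp
  then have "z + rt k (- j) * p = rt k 1 * cnj z + rt k (- j) * q"
    by (simp add: even(2) y' distrib_left flip: mult.assoc rt_add)
  from wall1[OF even(3,4) roots this]
  have "rt k (- j) * (u z * p) = rt k (- j) * (\<delta> z / u z * q)"
    by (simp add: mult_ac)
  then have *: "u z * p = \<delta> z / u z * q"
    by (simp only: mult_cancel_left rt_nonzero simp_thms)
  have "label y * p = (u z * p) * (\<delta> z / \<gamma> z) powi j"
    "label y' * q = (\<delta> z / u z * q) * (\<delta> z / \<gamma> z) powi j"
    using nonzero[OF even(3,4)]
    by (simp_all add: label_rotate[OF even(3,4)] even(2) y' power_int_add)
  then show ?thesis
    using * by simp
next
  case (odd j z)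
  have y': "y' = rt k j * z"
    unfolding assms(3) odd(1,2) complex_cnj_mult mult.assoc[symmetric] rt_mult_cnj by simp
  have roots: "(rt k (- j) * p) ^ k = 1" "(rt k (- j) * q) ^ k = 1"
    using assms(4,5) rt_power[OF k_pos] by (simp_all add: power_mult_distrib)
  have "rt k (- j) * (y + p) = rt k (- j) * (y' + q)"
    using assms(6) by simp
  then have "z + rt k (- j) * q = cnj z + rt k (- j) * p"
    by (simp add: odd(2) y' distrib_left flip: mult.assoc)
  from wall0[OF odd(3,4) roots(2,1) this]
  have "rt k (- j) * (u z * q) = rt k (- j) * (\<gamma> z / u z * p)"
    by (simp add: mult_ac)
  then have *: "u z * q = \<gamma> z / u z * p"
    by (simp only: mult_cancel_left rt_nonzero simp_thms)
  have "label y' * q = (u z * q) * (\<delta> z / \<gamma> z) powi j"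
    "label y * p = (\<gamma> z / u z * p) * (\<delta> z / \<gamma> z) powi j"
    by (simp_all add: label_rotate[OF odd(3,4)] odd(2) y')
  then show ?thesis
    using * by simp
qed

text \<open>Either both centers lie in the chamber that contains \<open>y\<close>, or the next
  mirror separates them strictly and \<open>mirror_image\<close> makes them reflections of each
  other in a wall of that chamber. No other adjacencies exist.\<close>

lemma label_edge_ordered:
  assumes "y \<in> Z" "y' \<in> Z" "p ^ k = 1" "q ^ k = 1" "y + p = y' + q"
    and y: "y = rcis r \<phi>" "0 < r" and y': "y' = rcis r' \<phi>'" "0 < r'"
    and "\<phi> \<le> \<phi>'" "\<phi>' \<le> \<phi> + pi"
  shows "label y * p = label y' * q"
proof -
  define n where "n = \<lfloor>\<phi> * of_nat k / pi\<rfloor>"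
  have yn: "y \<in> chamber k n"
    unfolding y(1) n_def using k_pos y(2) by (rule rcis_in_chamber)
  have n: "pi * of_int n / of_nat k \<le> \<phi>" "\<phi> < pi * of_int (n + 1) / of_nat k"
    using floor_angle[OF k_pos, of \<phi>] by (simp_all add: n_def)
  show ?thesis
  proof (cases "\<phi>' \<le> pi * of_int (n + 1) / of_nat k")
    case True
    then have "y' \<in> chamber k n"
      using y' n assms(10) by (intro chamberI[of _ r' \<phi>']) auto
    then show ?thesis
      using label_edge_same_chamber assms(1-5) yn by blast
  next
    case False
    \<comment> \<open>The bound \<open>\<phi>' \<le> \<phi> + pi\<close> keeps both angles to the
      mirror below \<open>pi\<close>; the floor makes the first one strictly positive.\<close>
    have "0 < sin (pi * of_int (n + 1) / of_nat k - \<phi>)" "0 < sin (\<phi>' - pi * of_int (n + 1) / of_nat k)"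
      using False n assms(10,11) by (intro sin_gt_zero; linarith)+
    moreover have "sin (\<phi> - pi * of_int (n + 1) / of_nat k) = - sin (pi * of_int (n + 1) / of_nat k - \<phi>)"
      by (simp flip: sin_minus)
    ultimately have "Im (cnj (mirror_dir k (n + 1)) * y) < 0" "Im (cnj (mirror_dir k (n + 1)) * y') > 0"
      unfolding y(1) y'(1) Im_mirror_dir_rcis using y(2) y'(2) by (simp_all add: mult_less_0_iff)
    then have "y' = rt k (n + 1) * cnj y"
      using mirror_image assms(1-5) by blast
    then show ?thesis
      using label_edge_mirror assms(1,3-5) yn by blast
  qed
qed

lemma label_edge:
  assumes "y \<in> Z" "y' \<in> Z" "y \<noteq> 0" "y' \<noteq> 0" "p ^ k = 1" "q ^ k = 1" "y + p = y' + q"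
  shows "label y * p = label y' * q"
proof -
  have ordered: "label y * p = label y' * q"
    if y: "y \<in> Z" "y' \<in> Z" "y \<noteq> 0" "y' \<noteq> 0" "p ^ k = 1" "q ^ k = 1" "y + p = y' + q" and le: "Arg y \<le> Arg y'" for y y' p q
  proof (cases "Arg y' \<le> Arg y + pi")
    case True
    then show ?thesis
      using label_edge_ordered[OF y(1,2,5,6,7) rcis_cmod_Arg[symmetric] _ rcis_cmod_Arg[symmetric]] y le by simp
  next
    case False
    \<comment> \<open>If the arguments are more than \<open>pi\<close> apart, a full turn is
      subtracted from the larger one and the two cells exchange roles.\<close>
    have lift: "y' = rcis (norm y') (Arg y' - 2 * pi)"
      by (simp add: rcis_def flip: cis_divide) (simp add: rcis_cmod_Arg flip: rcis_def)
    have "Arg y' - 2 * pi \<le> Arg y"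
      using Arg_bounded[of y] Arg_bounded[of y'] by linarith
    then show ?thesis
      using label_edge_ordered[OF y(2,1,6,5) y(7)[symmetric] lift _ rcis_cmod_Arg[of y, symmetric]] y False
      by simp
  qed
  show ?thesis
    using ordered[OF assms] ordered[OF assms(2,1,4,3,6,5) assms(7)[symmetric]]
    by (cases "Arg y \<le> Arg y'") simp_all
qed

lemma label_root_of_unity:
  assumes "y \<in> Z" "y \<noteq> 0"
  shows "label y ^ k = 1"
proof -
  have "y \<in> chamber k \<lfloor>Arg y * of_nat k / pi\<rfloor>"
    using rcis_in_chamber[OF k_pos, of "norm y" "Arg y"] assms(2) by (simp add: rcis_cmod_Arg)
  with assms(1) show ?thesis
    by (cases rule: chamber_cases)
      (auto simp: label_rotate power_mult_distrib power_divide units intro!: power_int_root_of_unity)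
qed

theorem well_labels_label: "well_labels k (Z - {0}) label"
  unfolding well_labels_def using label_edge label_root_of_unity by blast

end

section \<open>Extending a labeling of two adjacent slices\<close>

text \<open>The union of two neighboring areas when their common half-line is the positive real
  axis. The interval is half-open because an area contains only its left half-line.\<close>

definition sector :: "nat \<Rightarrow> complex set"
  where "sector k = {rcis r t | r t. 0 < r \<and> - 2 * pi / of_nat k < t \<and> t \<le> 2 * pi / of_nat k}"

text \<open>The sector contains chamber 0 together with its reflections in both walls. Chamber 1
  reaches exactly to the closed end, and chamber -1 stays clear of the open one.\<close>

lemma chamber_in_sector:
  assumes "0 < k" "n \<in> {-1, 0, 1}"
  shows "chamber k n \<subseteq> sector k"
proof
  fix y assume "y \<in> chamber k n"
  then obtain r \<phi> where y: "y = rcis r \<phi>" "0 < r"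
    "pi * of_int n / of_nat k \<le> \<phi>" "\<phi> \<le> pi * (of_int n + 1) / of_nat k"
    by (rule chamberE)
  have "- pi / of_nat k \<le> pi * of_int n / of_nat k" "pi * (of_int n + 1) / of_nat k \<le> 2 * pi / of_nat k"
    using assms by (auto simp: field_simps)
  moreover have "- 2 * pi / of_nat k < - pi / of_nat k"
    using assms by (simp add: field_simps)
  ultimately show "y \<in> sector k"
    using y unfolding sector_def by force
qed

section \<open>Folding data from a sector, and the cell in the center\<close>

context polygon_cells
begin

text \<open>For even \<open>k\<close> also \<open>- p\<close> and \<open>- q\<close> are vertex
  directions, so \<open>z - q = z' - p\<close> is a second common vertex and must be the first
  one.\<close>

lemma even_antipodal:
  assumes "even k" "z \<in> Z" "z' \<in> Z" "z \<noteq> z'" "p ^ k = 1" "q ^ k = 1" "z + p = z' + q"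
  shows "q = - p"
proof -
  have "z + - q = z' + - p"
    using assms(7) by (metis add.commute add_diff_cancel_right' add_uminus_conv_diff diff_add_eq)
  moreover have "(- q) ^ k = 1" "(- p) ^ k = 1"
    using assms by simp_all
  ultimately have "p = - q"
    using share_unique[OF assms(2-6)] assms(7) by blast
  then show ?thesis
    by simp
qed

lemma sector_images:
  assumes "z \<in> chamber k 0"
  shows "z \<in> sector k" "cnj z \<in> sector k" "rt k 1 * cnj z \<in> sector k"
  using chamber_in_sector[OF k_pos, of 0] chamber_in_sector[OF k_pos, of "- 1"]
    chamber_in_sector[OF k_pos, of 1] assms chamber_cnj[OF assms] chamber_mirror[OF assms]
  by (simp_all add: subset_iff)

lemma cnj_root: "p ^ k = 1 \<Longrightarrow> cnj p ^ k = 1"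
  by (metis complex_cnj_one complex_cnj_power)

text \<open>\<open>\<gamma>\<close> and \<open>\<delta>\<close> are the products of the label of a
  cell with the labels of its images in the two walls, which lie in the sector.\<close>

lemma folded_sector_labels:
  assumes u: "well_labels k (Z \<inter> sector k) u"
  shows "folded_labels k Z u (\<lambda>z. u z * u (cnj z)) (\<lambda>z. u z * u (rt k 1 * cnj z))"
proof
  note uD = well_labelsD[OF u]
  have in_dom: "z \<in> Z \<inter> sector k" "cnj z \<in> Z \<inter> sector k" "rt k 1 * cnj z \<in> Z \<inter> sector k"
    if "z \<in> Z" "z \<in> chamber k 0" for z
    using that sector_images cnj_closed mirror_closed by auto
  have nz: "u z \<noteq> 0" if "z \<in> Z \<inter> sector k" for z
    using uD(1)[OF that] k_pos by (auto simp: power_0_left)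
  show "u z ^ k = 1" "(u z * u (cnj z)) ^ k = 1" "(u z * u (rt k 1 * cnj z)) ^ k = 1"
    if "z \<in> Z" "z \<in> chamber k 0" for z
    using in_dom[OF that] uD(1) by (simp_all add: power_mult_distrib)
  show "u z * p = u z * u (cnj z) / u z * q"
    if "z \<in> Z" "z \<in> chamber k 0" "p ^ k = 1" "q ^ k = 1" "z + p = cnj z + q" for z p q
    using uD(2)[OF in_dom(1,2) that(3-5)] that nz in_dom by simp
  show "u z * p = u z * u (rt k 1 * cnj z) / u z * q"
    if "z \<in> Z" "z \<in> chamber k 0" "p ^ k = 1" "q ^ k = 1" "z + p = rt k 1 * cnj z + q" for z p q
    using uD(2)[OF in_dom(1,3) that(3-5)] that nz in_dom by simp
  fix z z' p q
  assume z: "z \<in> Z" "z \<in> chamber k 0" and z': "z' \<in> Z" "z' \<in> chamber k 0"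
    and pq: "p ^ k = 1" "q ^ k = 1" "z + p = z' + q"
  have *: "u z * p = u z' * q"
    using uD(2)[OF in_dom(1)[OF z] in_dom(1)[OF z'] pq] .
  have "cnj z + cnj p = cnj z' + cnj q"
    using pq(3) by (metis complex_cnj_add)
  then have c: "u (cnj z) * cnj p = u (cnj z') * cnj q"
    using uD(2)[OF in_dom(2)[OF z] in_dom(2)[OF z'] cnj_root[OF pq(1)] cnj_root[OF pq(2)]] by blast
  have "rt k 1 * cnj (z + p) = rt k 1 * cnj (z' + q)"
    using pq(3) by simp
  then have "rt k 1 * cnj z + rt k 1 * cnj p = rt k 1 * cnj z' + rt k 1 * cnj q"
    by (simp only: complex_cnj_add distrib_left)
  moreover have "(rt k 1 * cnj p) ^ k = 1" "(rt k 1 * cnj q) ^ k = 1"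
    using pq(1,2) rt_power[OF k_pos] by (simp_all add: power_mult_distrib cnj_root)
  ultimately have "u (rt k 1 * cnj z) * (rt k 1 * cnj p) = u (rt k 1 * cnj z') * (rt k 1 * cnj q)"
    using uD(2)[OF in_dom(3)[OF z] in_dom(3)[OF z']] by blast
  then have d: "u (rt k 1 * cnj z) * cnj p = u (rt k 1 * cnj z') * cnj q"
    by simp
  have unit: "p * cnj p = 1" "q * cnj q = 1"
    using norm_root_of_unity[OF k_pos] pq by (simp_all flip: complex_norm_square)
  \<comment> \<open>Along an adjacency a label changes by \<open>p / q\<close>, and that of the
    mirror image by the conjugate factor. On the unit circle these are inverse to each other, so the
    product is constant.\<close>
  have product: "a * b = a' * b'" if "a * p = a' * q" "b * cnj p = b' * cnj q" for a a' b b'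
  proof -
    have "a * b = (a * b) * (p * cnj p)"
      by (simp add: unit)
    also have "\<dots> = (a * p) * (b * cnj p)"
      by (simp only: mult_ac)
    also have "\<dots> = (a' * b') * (q * cnj q)"
      unfolding that by (simp only: mult_ac)
    finally show ?thesis
      by (simp add: unit)
  qed
  show "u z * p = u z' * q \<and> u z * u (cnj z) = u z' * u (cnj z') \<and>
    u z * u (rt k 1 * cnj z) = u z' * u (rt k 1 * cnj z')"
    using * product[OF * c] product[OF * d] by blast
qed

lemma well_labels_insert_center:
  assumes U: "well_labels k (Z - {0}) U" and c: "c ^ k = 1"
    and compat: "\<And>z p q. \<lbrakk>0 \<in> Z; z \<in> Z; z \<noteq> 0; p ^ k = 1; q ^ k = 1; p = z + q\<rbrakk> \<Longrightarrow> c * p = U z * q"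
  shows "well_labels k Z (U(0 := c))"
  unfolding well_labels_def
proof (intro conjI ballI allI impI)
  fix z assume "z \<in> Z"
  then show "(U(0 := c)) z ^ k = 1"
    using well_labelsD(1)[OF U] c by auto
next
  fix z z' p q
  assume z: "z \<in> Z" "z' \<in> Z" and pq: "p ^ k = 1" "q ^ k = 1" "z + p = z' + q"
  consider "z = z'" | "z = 0" "z' \<noteq> 0" | "z \<noteq> 0" "z' = 0" | "z \<noteq> 0" "z' \<noteq> 0"
    by blast
  then show "(U(0 := c)) z * p = (U(0 := c)) z' * q"
  proof cases
    case 1
    then show ?thesis
      using pq(3) by simp
  next
    case 2
    then have "p = z' + q"
      using pq(3) by simp
    with 2 z have "c * p = U z' * q"
      using compat[OF _ z(2) 2(2) pq(1,2)] by blast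
    then show ?thesis
      using 2 by simp
  next
    case 3
    then have "q = z + p"
      using pq(3) by simp
    with 3 z have "c * q = U z * p"
      using compat[OF _ z(1) 3(1) pq(2,1)] by blast
    then show ?thesis
      using 3 by simp
  next
    case 4
    then show ?thesis
      using well_labelsD(2)[OF U, of z z' p q] z pq by simp
  qed
qed

text \<open>A neighbor of the center cell would be centered at \<open>2 * p\<close>, and after a
  rotation at 2. For \<open>k > 6\<close> such a cell is too wide to stay below the mirror at angle
  \<open>pi / k\<close>.\<close>

lemma center_isolated_even:
  assumes "0 \<in> Z" "even k" "k \<noteq> 4" "k \<noteq> 6" "z \<in> Z" "p ^ k = 1" "q ^ k = 1" "p = z + q"
  shows "z = 0"
proof (rule ccontr)
  assume "z \<noteq> 0"
  then have "q = - p"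
    using even_antipodal[OF assms(2,1,5) _ assms(6,7)] assms(8) by simp
  then have z: "z = 2 * p"
    using assms(8) by simp
  have p: "cnj p ^ k = 1" "cnj p * p = 1"
    using assms(6) cnj_root norm_root_of_unity[OF k_pos] by (auto simp: complex_norm_square[symmetric] mult.commute)
  have "cnj p * z \<in> Z"
    using rotate[OF assms(5)] p by simp
  moreover have "cnj p * z = 2"
    using p(2) z by (simp add: mult_ac)
  ultimately have two: "2 \<in> Z"
    by simp
  have k: "6 < k"
    using assms(2-4) k_ge_3 by presburger
  define x where "x = pi / k"
  have x: "0 < x" "x < pi / 6"
    using k by (simp_all add: x_def field_simps)
  have sin_x: "0 < sin x" "sin x < 1 / 2"
    using x sin_monotone_2pi[of x "pi / 6"] sin_gt_zero[of x] sin_30 by auto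
  have "Im (cnj (mirror_dir k 1) * 2) < 0"
    using sin_x by (simp add: mirror_dir_def x_def)
  \<comment> \<open>The vertex \<open>2 + rt k 2\<close> is the one that crosses. Below the mirror
    it would give \<open>sin (3 * x) \<le> 2 * sin x\<close>, which fails once
    \<open>sin x < 1 / 2\<close>; equality at \<open>k = 6\<close> is where hexagons touch.\<close>
  from same_side_neg[OF two rt_power[OF k_pos, of 2] this]
  have "Im (cnj (mirror_dir k 1) * (2 + rt k 2)) \<le> 0" .
  moreover have "cnj (mirror_dir k 1) * rt k 2 = cis (3 * x)"
    by (simp add: mirror_dir_def rt_def cis_cnj cis_mult x_def diff_divide_distrib[symmetric])
  ultimately have "Im (2 * cnj (mirror_dir k 1)) + Im (cis (3 * x)) \<le> 0"
    by (simp only: distrib_left plus_complex.sel mult.commute)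
  then have "sin (3 * x) \<le> 2 * sin x"
    by (simp add: mirror_dir_def x_def)
  moreover have "sin (2 * x + x) = sin x * (3 - 4 * (sin x)\<^sup>2)"
    unfolding sin_add sin_double cos_double_sin using sin_cos_squared_add[of x] by algebra
  then have "sin (3 * x) = sin x * (3 - 4 * (sin x)\<^sup>2)"
    by (simp add: algebra_simps)
  moreover have "(sin x)\<^sup>2 < (1 / 2)\<^sup>2"
    using sin_x by (intro power_strict_mono) auto
  then have "2 * sin x < sin x * (3 - 4 * (sin x)\<^sup>2)"
    using sin_x(1) by (simp add: power2_eq_square)
  ultimately show False
    by linarith
qed

text \<open>A neighbor can be moved to the center \<open>1 - rt k a\<close> with
  \<open>0 < 2 * a < k\<close>. The mirrors 0 and -1 bound \<open>a\<close> from above and below,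
  and the bounds are compatible only for triangles.\<close>

lemma center_isolated_odd:
  assumes "odd k" "k \<noteq> 3" "p ^ k = 1" "q ^ k = 1" "p - q \<in> Z"
  shows "p = q"
proof (rule ccontr)
  assume "p \<noteq> q"
  have unit: "cnj p * p = 1" "(cnj p) ^ k = 1"
    using assms(3) cnj_root norm_root_of_unity[OF k_pos] by (auto simp: complex_norm_square[symmetric] mult.commute)
  obtain b where b: "0 \<le> b" "b < int k" "cnj p * q = rt k b"
    using root_of_unity_rt[OF k_pos, of "cnj p * q"] unit(2) assms(4) by (auto simp: power_mult_distrib)
  have "b \<noteq> 0"
  proof
    assume "b = 0"
    then have "cnj p * q = cnj p * p"
      using b unit by simp
    moreover have "cnj p \<noteq> 0"
      using unit(1) by auto
    ultimately show False
      using \<open>p \<noteq> q\<close> by (metis mult_cancel_left)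
  qed
  have "cnj p * (p - q) \<in> Z"
    using rotate assms(5) unit(2) by blast
  then have bZ: "1 - rt k b \<in> Z"
    using b(3) unit(1) by (simp add: right_diff_distrib)
  \<comment> \<open>Conjugation replaces \<open>b\<close> by \<open>k - b\<close>; as
    \<open>k\<close> is odd, one of the two is below \<open>k / 2\<close>.\<close>
  have "rt k (- b) = rt k (int k - b)"
    using rt_multiple[OF k_pos, of 1] rt_add[of k "int k" "- b"] by simp
  then have "1 - rt k (int k - b) \<in> Z"
    using cnj_closed[OF bZ] by (simp add: rt_minus)
  moreover have "2 * (int k - b) < int k" if "\<not> 2 * b < int k"
    using that assms(1) by presburger
  ultimately obtain a where a: "0 < a" "2 * a < int k" "1 - rt k a \<in> Z"
    using bZ b(1,2) \<open>b \<noteq> 0\<close>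
    by (metis diff_gt_0_iff_gt order_le_less)
  define x where "x = pi / k"
  have x: "0 < x" "of_nat k * x = pi"
    using k_pos by (simp_all add: x_def)
  have rt_x: "rt k j = cis (2 * of_int j * x)" for j
    by (simp add: rt_def x_def mult_ac)
  have ax_x: "cnj (mirror_dir k (- 1)) = cis x"
    by (simp add: mirror_dir_def x_def cis_cnj)
  have "2 * of_int a * x < of_nat k * x"
    using a(2) x(1) by (intro mult_strict_right_mono) linarith+
  then have a_x: "0 < of_int a * x" "2 * of_int a * x < pi"
    using a(1) x by simp_all
  have "0 < x" "x < pi"
    using x k_ge_3 by (simp_all add: x_def field_simps)
  then have "0 < sin x"
    by (rule sin_gt_zero)
  \<comment> \<open>The center lies below the real axis, so its vertex in direction
    \<open>rt k (a - 1)\<close> must not rise above it. This gives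
    \<open>4 * a - 2 \<le> k\<close>.\<close>
  have "Im (cnj (mirror_dir k 0) * (1 - rt k a)) < 0"
    using a_x sin_gt_zero[of "2 * of_int a * x"] by (simp add: mirror_dir_def rt_x mult.assoc)
  from same_side_neg[OF a(3) rt_power[OF k_pos, of "a - 1"] this]
  have "0 \<le> sin (2 * of_int a * x) - sin (2 * of_int (a - 1) * x)"
    by (simp add: mirror_dir_def rt_x)
  also have "\<dots> = 2 * sin x * cos ((2 * of_int a - 1) * x)"
    by (simp add: sin_diff_sin algebra_simps diff_divide_distrib add_divide_distrib)
  finally have "0 \<le> cos ((2 * of_int a - 1) * x)"
    using \<open>0 < sin x\<close> by (simp add: zero_le_mult_iff)
  then have "(2 * of_int a - 1) * x \<le> pi / 2"
    using cos_lt_zero_pi[of "(2 * of_int a - 1) * x"] a_x x by (force simp: algebra_simps)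
  then have "(4 * of_int a - 2) * x \<le> of_nat k * x"
    using x by (simp add: algebra_simps)
  then have "real_of_int (4 * a - 2) \<le> real_of_int (int k)"
    using x(1) by simp
  then have upper: "4 * a - 2 \<le> int k"
    unfolding of_int_le_iff .
  \<comment> \<open>The vertex in direction \<open>rt k a\<close> is the point 1, strictly above
    mirror -1, so the center is not strictly below that mirror. This gives
    \<open>k \<le> 2 * a + 2\<close>.\<close>
  have "\<not> Im (cnj (mirror_dir k (- 1)) * (1 - rt k a)) < 0"
    using same_side_neg[OF a(3) rt_power[OF k_pos, of a], of "- 1"] \<open>0 < sin x\<close> by (auto simp: ax_x)
  then have "0 \<le> sin x - sin ((2 * of_int a + 1) * x)"
    by (simp add: ax_x rt_x right_diff_distrib cis_mult algebra_simps)
  also have "\<dots> = 2 * sin (- (of_int a * x)) * cos ((of_int a + 1) * x)"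
    by (simp add: sin_diff_sin algebra_simps diff_divide_distrib add_divide_distrib)
  finally have "sin (of_int a * x) * cos ((of_int a + 1) * x) \<le> 0"
    by simp
  moreover have "0 < sin (of_int a * x)"
    using a_x by (intro sin_gt_zero) auto
  ultimately have "cos ((of_int a + 1) * x) \<le> 0"
    by (simp add: mult_le_0_iff)
  then have "pi / 2 \<le> (of_int a + 1) * x"
    using cos_gt_zero_pi[of "(of_int a + 1) * x"] a_x x by (force simp: algebra_simps)
  then have "of_nat k * x \<le> (2 * of_int a + 2) * x"
    using x by (simp add: algebra_simps)
  then have "real_of_int (int k) \<le> real_of_int (2 * a + 2)"
    using x(1) by simp
  then have "int k \<le> 2 * a + 2"
    unfolding of_int_le_iff .
  \<comment> \<open>An odd \<open>k\<close> between these bounds equals \<open>2 * a + 1\<close>;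
    the upper bound on \<open>a\<close> then leaves only \<open>a = 1\<close> and
    \<open>k = 3\<close>.\<close>
  with upper show False
    using assms(1,2) k_ge_3 by presburger
qed

text \<open>If the center cell has neighbors, then they prescribe the same label for it because the
  adjacencies through both walls at \<open>z0\<close> force \<open>\<gamma> z0 = \<delta> z0\<close>.\<close>

lemma extend_triangles:
  assumes "k = 3" and u: "well_labels k (Z \<inter> sector k) u"
  obtains U where "well_labels k Z U"
proof -
  interpret folded_labels k Z u "\<lambda>z. u z * u (cnj z)" "\<lambda>z. u z * u (rt k 1 * cnj z)"
    using u by (rule folded_sector_labels)
  \<comment> \<open>The cell in chamber 0 that touches the center cell at the vertex 1; every
    neighbor of the center is a dihedral image of it.\<close>
  define z0 where "z0 = 1 - rt k 2"
  have "rt 3 1 = Complex (- (1 / 2)) (sqrt 3 / 2)"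
    by (simp add: rt_def complex_eq_iff cos_120 sin_120)
  then have rt3: "rt k 1 = Complex (- (1 / 2)) (sqrt 3 / 2)"
    using assms(1) by simp
  have rt_3: "rt k 3 = 1"
    using rt_multiple[OF k_pos, of 1] assms(1) by simp
  have rt2: "rt k 2 = cnj (rt k 1)" "rt k 1 * rt k 2 = 1" "rt k 2 * rt k 2 = rt k 1" "rt k 1 * rt k 1 = rt k 2"
  proof -
    have "rt k 2 = rt k 3 * rt k (- 1)" "rt k 1 * rt k 2 = rt k 3" "rt k 2 * rt k 2 = rt k 3 * rt k 1"
      by (simp_all flip: rt_add)
    then show "rt k 2 = cnj (rt k 1)" "rt k 1 * rt k 2 = 1" "rt k 2 * rt k 2 = rt k 1"
      by (simp_all add: rt_3 rt_minus)
    show "rt k 1 * rt k 1 = rt k 2"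
      by (simp flip: rt_add)
  qed
  have z0: "z0 = rcis (sqrt 3) (pi / 6)" "cnj z0 = 1 - rt k 1"
    by (simp_all add: z0_def rt2(1) rt3 rcis_def complex_eq_iff cos_30 sin_30)
  have chamber: "z0 \<in> chamber k 0"
    by (rule chamberI[OF z0(1)]) (simp_all add: assms(1))
  have neighbour: "(z = rt k j * z0 \<and> q = rt k (j + 2)) \<or> (z = rt k j * cnj z0 \<and> q = rt k (j + 1))"
    if "z \<noteq> 0" "q ^ k = 1" "rt k j = z + q" for z q j
  proof -
    have "(rt k (- j) * q) ^ k = 1"
      using that(2) rt_power[OF k_pos] by (simp add: power_mult_distrib)
    then obtain m where m: "0 \<le> m" "m < int k" "rt k (- j) * q = rt k m"
      by (rule root_of_unity_rt[OF k_pos])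
    have "rt k j * (rt k (- j) * q) = rt k j * rt k m"
      using m(3) by simp
    then have q: "q = rt k (j + m)"
      by (simp add: rt_add flip: mult.assoc)
    have "m \<noteq> 0"
      using q that(1,3) by (metis add.right_neutral add_cancel_left_left)
    then have "m = 1 \<or> m = 2"
      using m(1,2) assms(1) by auto
    moreover have "z = rt k j * (1 - rt k m)"
      using that(3) q by (simp add: rt_add algebra_simps)
    ultimately show ?thesis
      using q z0(2) by (auto simp: z0_def)
  qed
  \<comment> \<open>The label forced by the adjacency at the vertex 1. If \<open>z0\<close> is no
    cell, the center has no neighbors and 1 is a harmless default.\<close>
  define c where "c = (if z0 \<in> Z then u z0 * rt k 2 else 1)"
  have "well_labels k Z (label(0 := c))"
  proof (rule well_labels_insert_center[OF well_labels_label])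
    show "c ^ k = 1"
      using units(1)[OF _ chamber] rt_power[OF k_pos] by (simp add: c_def power_mult_distrib)
    fix z p q
    assume z: "z \<in> Z" "z \<noteq> 0" and pq: "p ^ k = 1" "q ^ k = 1" "p = z + q"
    obtain j where j: "p = rt k j"
      using root_of_unity_rt[OF k_pos pq(1)] by blast
    note nb = neighbour[OF z(2) pq(2) pq(3)[unfolded j]]
    have "rt k (- j) * z \<in> Z"
      using z rotate rt_power k_pos by blast
    moreover have "rt k (- j) * z \<in> {z0, cnj z0}"
      using nb by (auto simp flip: mult.assoc)
    ultimately have z0Z: "z0 \<in> Z"
      using cnj_closed by fastforce
    have uz: "u z0 \<noteq> 0"
      using units(1)[OF z0Z chamber] k_pos by (auto simp: power_0_left)
    \<comment> \<open>The cell \<open>z0\<close> touches its images in both walls. Both get the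
      label \<open>u z0 * rt k 1\<close>, so rotating a neighbor of the center leaves its label
      unchanged.\<close>
    have "z0 + rt k 2 = cnj z0 + rt k 1"
      by (simp add: z0(2)) (simp add: z0_def)
    then have "u z0 * rt k 2 = u (cnj z0) * rt k 1"
      using wall0[OF z0Z chamber rt_power[OF k_pos] rt_power[OF k_pos], of 2 1] uz by simp
    then have "u z0 * rt k 2 * rt k 2 = u (cnj z0) * (rt k 1 * rt k 2)"
      by simp
    then have 0: "u (cnj z0) = u z0 * rt k 1"
      by (simp add: rt2(2,3) mult.assoc)
    have "z0 + rt k 1 = rt k 1 * cnj z0 + 1"
      by (simp add: z0(2) right_diff_distrib rt2(4)) (simp add: z0_def)
    then have 1: "u (rt k 1 * cnj z0) = u z0 * rt k 1"
      using wall1[OF z0Z chamber rt_power[OF k_pos], of 1 1] uz by simp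
    have rot: "label (rt k j * z0) = u z0" "label (rt k j * cnj z0) = u z0 * rt k 1"
      using label_rotate[OF z0Z chamber, of j] uz unfolding 0 1 by simp_all
    from nb show "c * p = label z * q"
    proof (elim disjE conjE)
      assume nb: "z = rt k j * z0" "q = rt k (j + 2)"
      have "c * p = u z0 * rt k 2 * rt k j"
        using z0Z by (simp only: c_def j if_True)
      then show ?thesis
        unfolding nb rot rt_add by (simp only: mult_ac)
    next
      assume nb: "z = rt k j * cnj z0" "q = rt k (j + 1)"
      have "c * p = u z0 * (rt k 1 * rt k 1) * rt k j"
        using z0Z by (simp only: c_def j rt2(4) if_True)
      then show ?thesis
        unfolding nb rot rt_add by (simp only: mult_ac)
    qed
  qed
  then show thesis
    by (rule that)
qed

text \<open>Adjacent squares are translates by \<open>2 * p\<close>, so their labels differ by a sign and can be normalized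
  to \<open>1\<close> and \<open>- 1\<close>. No adjacency crosses a diagonal mirror, hence \<open>\<delta> = 1\<close> is admissible.\<close>

lemma extend_squares:
  assumes "k = 4" and u: "well_labels k (Z \<inter> sector k) u"
  obtains U where "well_labels k Z U"
proof -
  \<comment> \<open>Chooses one root from each pair of opposite fourth roots of unity, so that
    opposite labels become opposite signs.\<close>
  define u' where "u' z = (if u z \<in> {1, \<i>} then 1 else - 1 :: complex)" for z
  have u'_sq: "u' z * u' z = 1" for z
    by (simp add: u'_def)
  have fourth: "x \<in> {1, \<i>, - 1, - \<i>}" if "x ^ k = 1" for x :: complex
  proof -
    have "(x - 1) * (x + 1) * ((x - \<i>) * (x + \<i>)) = x ^ 4 - 1"
      by (simp add: algebra_simps power4_eq_xxxx)
    then show ?thesis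
      using that assms(1) by (auto simp: eq_neg_iff_add_eq_0)
  qed
  have u': "well_labels k (Z \<inter> sector k) u'"
    unfolding well_labels_def
  proof (intro conjI ballI allI impI)
    show "u' z ^ k = 1" for z
      by (simp add: u'_def assms(1))
    fix z z' p q
    assume z: "z \<in> Z \<inter> sector k" "z' \<in> Z \<inter> sector k" and pq: "p ^ k = 1" "q ^ k = 1" "z + p = z' + q"
    show "u' z * p = u' z' * q"
    proof (cases "z = z'")
      case False
      then have q: "q = - p"
        using even_antipodal[of z z' p q] z pq assms(1) by simp
      have "p \<noteq> 0"
        using pq(1) k_pos by (auto simp: power_0_left)
      have "u z * p = u z' * - p"
        using well_labelsD(2)[OF u z pq] q by simp
      then have "(u z + u z') * p = 0"
        by (simp add: algebra_simps)
      then have "u z' = - u z"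
        using \<open>p \<noteq> 0\<close> by (simp add: eq_neg_iff_add_eq_0 add.commute)
      then have "u' z' = - u' z"
        using fourth[OF well_labelsD(1)[OF u z(1)]] by (auto simp: u'_def complex_eq_iff)
      then show ?thesis
        using q by simp
    qed (use pq in simp)
  qed
  interpret fl: folded_labels k Z u' "\<lambda>z. u' z * u' (cnj z)" "\<lambda>z. u' z * u' (rt k 1 * cnj z)"
    using u' by (rule folded_sector_labels)
  have rt_i: "rt k 1 = \<i>"
    by (simp add: rt_def assms(1))
  interpret folded_labels k Z u' "\<lambda>z. u' z * u' (cnj z)" "\<lambda>_. 1"
  proof
    show "u' z * p = 1 / u' z * q"
      if z: "z \<in> Z" "z \<in> chamber k 0" and pq: "p ^ k = 1" "q ^ k = 1" "z + p = rt k 1 * cnj z + q" for z p q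
    proof (cases "z = rt k 1 * cnj z")
      case True
      then have "p = q"
        using pq(3) by simp
      then show ?thesis
        by (simp add: u'_def)
    next
      case False
      have "q = - p"
        using even_antipodal[OF _ z(1) mirror_closed[OF z(1)] False pq] assms(1) by simp
      \<comment> \<open>A cell touching its image in the diagonal would make \<open>2 * p\<close> a
        real multiple of \<open>1 - \<i>\<close>, but the fourth power of \<open>1 - \<i>\<close> is
        negative while that of \<open>2 * p\<close> is 16.\<close>
      define x where "x = Im z - Re z"
      have diagonal: "2 * p = of_real x * (1 - \<i>)"
        using pq(3) rt_i \<open>q = - p\<close> by (simp add: complex_eq_iff x_def)
      have fourth_power: "(1 - \<i>) ^ 4 = - 4"
        by (simp add: power4_eq_xxxx complex_eq_iff)
      have "complex_of_real 16 = (2 * p) ^ 4"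
        using pq(1) assms(1) by (simp add: power_mult_distrib)
      also have "\<dots> = complex_of_real (x ^ 4 * (- 4))"
        unfolding diagonal power_mult_distrib fourth_power by simp
      finally have "complex_of_real 16 = complex_of_real (x ^ 4 * (- 4))" .
      then have "16 = x ^ 4 * (- 4)"
        by (simp only: of_real_eq_iff)
      moreover have "0 \<le> x ^ 4"
        by simp
      ultimately show ?thesis
        by linarith
    qed
  next
    show "u' z * p = u' z' * q \<and> u' z * u' (cnj z) = u' z' * u' (cnj z') \<and> (1 :: complex) = 1"
      if "z \<in> Z" "z \<in> chamber k 0" "z' \<in> Z" "z' \<in> chamber k 0"
        "p ^ k = 1" "q ^ k = 1" "z + p = z' + q" for z z' p q
      using fl.inside[OF that] by blast
  qed (fact fl.units(1), fact fl.units(2), simp, fact fl.wall0)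
  \<comment> \<open>The neighbors of the center are the rotations of 2. The point 2 is fixed by
    \<open>cnj\<close>, so \<open>\<gamma>\<close> and \<open>\<delta>\<close> are both 1 there and
    all neighbors carry the label \<open>u' 2\<close>.\<close>
  have "well_labels k Z (label(0 := - u' 2))"
  proof (rule well_labels_insert_center[OF well_labels_label])
    show "(- u' 2) ^ k = 1"
      by (simp add: u'_def assms(1))
    fix z p q
    assume z: "0 \<in> Z" "z \<in> Z" "z \<noteq> 0" and pq: "p ^ k = 1" "q ^ k = 1" "p = z + q"
    have "0 + p = z + q"
      using pq(3) by simp
    then have q: "q = - p"
      using even_antipodal[OF _ z(1,2) _ pq(1,2)] z(3) assms(1) by simp
    obtain j where j: "p = rt k j"
      using root_of_unity_rt[OF k_pos pq(1)] by blast
    have "z = p - q"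
      using pq(3) by simp
    then have z2: "z = rt k j * 2"
      unfolding q j by simp
    have "rt k (- j) * z \<in> Z"
      using z rotate rt_power k_pos by blast
    then have "2 \<in> Z"
      unfolding z2 by (simp flip: mult.assoc)
    moreover have "2 \<in> chamber k 0"
      by (rule chamberI[of _ 2 0]) (simp_all add: complex_eq_iff)
    ultimately have "label z = u' 2"
      unfolding z2 using label_rotate(1)[of 2 j] by (simp add: u'_sq)
    then show "- u' 2 * p = label z * q"
      using q by simp
  qed
  then show thesis
    by (rule that)
qed

theorem extend_sector_labels:
  assumes u: "well_labels k (Z \<inter> sector k) u" and hexagon: "k = 6 \<Longrightarrow> 0 \<notin> Z"
  obtains U where "well_labels k Z U"
proof (cases "k = 3 \<or> k = 4")
  case True
  then show thesis
    using extend_triangles[OF _ u] extend_squares[OF _ u] that by blast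
next
  case False
  interpret folded_labels k Z u "\<lambda>z. u z * u (cnj z)" "\<lambda>z. u z * u (rt k 1 * cnj z)"
    using u by (rule folded_sector_labels)
  have "well_labels k Z (label(0 := 1))"
  proof (rule well_labels_insert_center[OF well_labels_label])
    fix z p q
    assume z: "0 \<in> Z" "z \<in> Z" "z \<noteq> 0" and pq: "p ^ k = 1" "q ^ k = 1" "p = z + q"
    have "z = p - q"
      using pq(3) by simp
    have False
    proof (cases "even k")
      case True
      then show False
        using center_isolated_even[OF z(1) True _ _ z(2) pq] hexagon z False by auto
    next
      case odd: False
      then show False
        using center_isolated_odd[OF odd _ pq(1,2)] z \<open>z = p - q\<close> False by auto
    qed
    then show "1 * p = label z * q" ..
  qed simp
  then show thesis
    by (rule that)
qed

end

section \<open>Cut points and mirrors\<close>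

text \<open>In a separation of \<open>A\<close>, the piece containing \<open>p\<close> can absorb
  \<open>B\<close>, which would separate the whole union.\<close>

lemma connected_closed_part:
  fixes A B :: "'a::t1_space set"
  assumes "connected (A \<union> B)" "closed A" "closed B" "A \<inter> B = {p}"
  shows "connected A"
proof -
  have impossible: False
    if E: "closed E" "closed F" "A \<subseteq> E \<union> F" "E \<inter> F \<inter> A = {}" "F \<inter> A \<noteq> {}" "p \<in> E" for E F
  proof -
    have "p \<in> A" "p \<notin> F"
      using assms(4) E(4,6) by blast+
    have "closed (E \<inter> A \<union> B)" "closed (F \<inter> A)"
      using assms E by auto
    moreover have "(E \<inter> A \<union> B) \<inter> (F \<inter> A) \<inter> (A \<union> B) = {}"
      using E(4) assms(4) \<open>p \<notin> F\<close> by auto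
    moreover have "A \<union> B \<subseteq> (E \<inter> A \<union> B) \<union> (F \<inter> A)"
      using E(3) by auto
    moreover have "(E \<inter> A \<union> B) \<inter> (A \<union> B) \<noteq> {}"
      using E(6) \<open>p \<in> A\<close> by auto
    moreover have "(F \<inter> A) \<inter> (A \<union> B) \<noteq> {}"
      using E(5) by auto
    ultimately show False
      using connected_closedD[OF assms(1)] by blast
  qed
  have "p \<in> A"
    using assms(4) by blast
  then have p: "p \<in> E \<or> p \<in> F" if "A \<subseteq> E \<union> F" for E F
    using that by blast
  show ?thesis
    unfolding connected_closed
  proof (intro notI, elim exE conjE)
    fix E F
    assume EF: "closed E" "closed F" "A \<subseteq> E \<union> F" "E \<inter> F \<inter> A = {}" "E \<inter> A \<noteq> {}" "F \<inter> A \<noteq> {}"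
    from p[OF EF(3)] show False
    proof
      assume "p \<in> E"
      with EF show False
        using impossible[of E F] by simp
    next
      assume "p \<in> F"
      with EF show False
        using impossible[of F E] by (simp add: Un_commute Int_commute)
    qed
  qed
qed

text \<open>If a point of \<open>A\<close> other than \<open>p\<close> were the image of \<open>p\<close> under a symmetry \<open>g\<close>, then whichever
  of \<open>g ` A\<close> and \<open>g ` B\<close> avoids the cut point \<open>p\<close> would fit into \<open>A - {p}\<close>, which contains too
  few points of \<open>V\<close>.\<close>

lemma smaller_side_of_cut:
  fixes A B V :: "'a::t1_space set"
  assumes conn: "connected (A \<union> B)" and closed: "closed A" "closed B" and cut: "A \<inter> B = {p}"
    and V: "finite V" "p \<in> V" and card: "card (A \<inter> V) \<le> card (B \<inter> V)"
    and transitive: "\<And>v. v \<in> V \<Longrightarrow> \<exists>g. g p = v \<and> continuous_on UNIV g \<and> inj g \<and>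
      g ` (A \<union> B) = A \<union> B \<and> g ` V = V"
  shows "A \<inter> V = {p}"
proof (rule ccontr)
  assume "A \<inter> V \<noteq> {p}"
  moreover have pA: "p \<in> A \<inter> V"
    using cut V by blast
  ultimately obtain v where v: "v \<in> A" "v \<in> V" "v \<noteq> p"
    by blast
  obtain g where g: "g p = v" "continuous_on UNIV g" "inj g" "g ` (A \<union> B) = A \<union> B" "g ` V = V"
    using transitive[OF v(2)] by blast
  have "g ` A \<inter> g ` B = {v}"
    using image_Int[OF g(3), of A B] cut g(1) by simp
  have small: False if C: "connected C" "v \<in> g ` C" "C \<subseteq> A \<union> B" "p \<notin> g ` C" "card (A \<inter> V) \<le> card (C \<inter> V)" for C
  proof -
    have "g ` C \<subseteq> A \<union> B"
      using C(3) g(4) by blast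
    moreover have "connected (g ` C)"
      using C(1) g(2) continuous_on_subset connected_continuous_image by blast
    moreover have "A \<inter> B \<inter> g ` C = {}"
      using cut C(4) by simp
    ultimately have "A \<inter> g ` C = {} \<or> B \<inter> g ` C = {}"
      using connected_closedD closed by blast
    then have "g ` C \<inter> B = {}"
      using C(2) v(1) by blast
    then have "g ` (C \<inter> V) \<subseteq> (A \<inter> V) - {p}"
      using \<open>g ` C \<subseteq> A \<union> B\<close> g(5) C(4) by blast
    then have "card (g ` (C \<inter> V)) \<le> card ((A \<inter> V) - {p})"
      using V(1) by (intro card_mono) auto
    also have "\<dots> < card (A \<inter> V)"
      using pA V(1) by (intro card_Diff1_less) auto
    also have "\<dots> \<le> card (C \<inter> V)"
      by (rule C(5))
    also have "\<dots> = card (g ` (C \<inter> V))"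
      using g(3) by (simp add: card_image inj_on_subset)
    finally show False
      by simp
  qed
  have "connected A" "connected B"
    using connected_closed_part[of A B p] connected_closed_part[of B A p] conn closed cut
    by (simp_all add: Un_commute Int_commute)
  moreover have "p \<notin> g ` A \<or> p \<notin> g ` B"
    using \<open>g ` A \<inter> g ` B = {v}\<close> v(3) by (metis IntI singletonD)
  moreover have "v \<in> g ` A" "v \<in> g ` B"
    using \<open>g ` A \<inter> g ` B = {v}\<close> by blast+
  ultimately show False
    using small[of A] small[of B] card by auto
qed

text \<open>Strict convexity of the disc: the squared norm of the combination is 1 minus
  \<open>t * (1 - t)\<close> times the squared distance of \<open>p\<close> and
  \<open>q\<close>.\<close>

lemma convex_combination_on_circle:
  fixes p q :: complex
  assumes "norm p = 1" "norm q = 1" "0 < t" "t < 1" "norm (of_real (1 - t) * p + of_real t * q) = 1"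
  shows "p = q"
proof -
  have sq: "(Re x)\<^sup>2 + (Im x)\<^sup>2 = 1" if "norm x = 1" for x
    using that cmod_power2[of x] by simp
  have "t * (1 - t) * ((Re p - Re q)\<^sup>2 + (Im p - Im q)\<^sup>2) = 0"
    using sq[OF assms(1)] sq[OF assms(2)] sq[OF assms(5)] by simp algebra
  then show ?thesis
    using assms(3,4) by (simp add: complex_eq_iff sum_power2_eq_zero_iff)
qed

text \<open>The fractal in coordinates where its vertices are the \<open>k\<close>-th roots of
  unity. The map of the cell \<open>z\<close> takes \<open>x\<close> to \<open>(x + z) / L\<close>;
  \<open>corner\<close> gives the cell whose map fixes the vertex \<open>p\<close>.\<close>

locale normalized_fractal =
  fixes k :: nat and L :: real and K Z :: "complex set"
  assumes k_ge_3: "3 \<le> k" and L_gt_1: "1 < L"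
    and closed_K: "closed K" and connected_K: "connected K"
    and roots_in_K: "p ^ k = 1 \<Longrightarrow> p \<in> K"
    and mirror_K: "\<lbrakk>x \<in> K; p ^ k = 1\<rbrakk> \<Longrightarrow> p * cnj x \<in> K"
    and mirror_Z: "\<lbrakk>z \<in> Z; p ^ k = 1\<rbrakk> \<Longrightarrow> p * cnj z \<in> Z"
    and self_similar: "\<lbrakk>x \<in> K; z \<in> Z\<rbrakk> \<Longrightarrow> (x + z) / of_real L \<in> K"
    and corner: "p ^ k = 1 \<Longrightarrow> of_real (L - 1) * p \<in> Z"
    and nested: "\<lbrakk>z \<in> Z; z' \<in> Z; z \<noteq> z'; x \<in> K; x' \<in> K; z + x = z' + x'\<rbrakk> \<Longrightarrow> x ^ k = 1"
begin

lemma rotate_K: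
  assumes "x \<in> K" "p ^ k = 1"
  shows "p * x \<in> K"
  using mirror_K[OF mirror_K[OF assms(1), of 1] assms(2)] by simp

text \<open>With two common vertices, the cells would also share the point at fraction
  \<open>1 / L\<close> between them, which belongs to a corner subcell. By nesting it is a vertex,
  hence on the circle, so the two vertices agree.\<close>

lemma common_vertex_unique:
  assumes z: "z \<in> Z" "z' \<in> Z" "z \<noteq> z'" and roots: "p ^ k = 1" "q ^ k = 1" "p' ^ k = 1" "q' ^ k = 1"
    and eq: "z + p = z' + q" "z + p' = z' + q'"
  shows "p = p'"
proof -
  define t where "t = 1 / L"
  have t: "0 < t" "t < 1"
    using L_gt_1 by (simp_all add: t_def)
  have comb: "(y + of_real (L - 1) * x) / of_real L = of_real (1 - t) * x + of_real t * y" for x y :: complex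
    using L_gt_1 by (simp add: t_def field_simps)
  have "of_real (1 - t) * x + of_real t * y \<in> K" if "x ^ k = 1" "y ^ k = 1" for x y
    unfolding comb[symmetric] using that by (intro self_similar roots_in_K corner)
  then have "of_real (1 - t) * p + of_real t * p' \<in> K" "of_real (1 - t) * q + of_real t * q' \<in> K"
    using roots by blast+
  moreover have q: "q = z + p - z'" "q' = z + p' - z'"
    using eq by (simp_all add: algebra_simps)
  have "z + (of_real (1 - t) * p + of_real t * p') = z' + (of_real (1 - t) * q + of_real t * q')"
    unfolding q of_real_diff of_real_1 by algebra
  ultimately have "(of_real (1 - t) * p + of_real t * p') ^ k = 1"
    using nested[OF z] by blast
  moreover have norm1: "norm x = 1" if "x ^ k = 1" for x :: complex
    using norm_root_of_unity[OF _ that] k_ge_3 by simp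
  ultimately show ?thesis
    using convex_combination_on_circle[OF norm1[OF roots(1)] norm1[OF roots(3)] t] by blast
qed

text \<open>Otherwise the mirror splits \<open>K\<close> at a single point, a vertex, with further
  vertices strictly on both sides. This contradicts \<open>smaller_side_of_cut\<close>.\<close>

lemma vertices_same_side:
  assumes z: "z \<in> Z" and p: "p ^ k = 1" and pos: "Im (cnj (mirror_dir k c) * z) > 0"
  shows "Im (cnj (mirror_dir k c) * (z + p)) \<ge> 0"
proof (rule ccontr)
  define f where "f y = Im (cnj (mirror_dir k c) * y)" for y
  define V where "V = {x::complex. x ^ k = 1}"
  define A where "A = {x \<in> K. f (z + x) \<le> 0}"
  define B where "B = {x \<in> K. 0 \<le> f (z + x)}"
  assume "\<not> Im (cnj (mirror_dir k c) * (z + p)) \<ge> 0"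
  then have neg: "f (z + p) < 0"
    by (simp add: f_def)
  have k0: "0 < k"
    using k_ge_3 by simp
  have V: "finite V" "V \<subseteq> K"
    using k0 roots_in_K by (auto simp: V_def intro: finite_roots_unity)
  have cont: "continuous_on S (\<lambda>x. f (z + x))" for S
    unfolding f_def by (intro continuous_intros)
  have AB: "closed A" "closed B" "A \<union> B = K"
    using closed_K continuous_closed_preimage[OF cont closed_K, of "{..0}"]
      continuous_closed_preimage[OF cont closed_K, of "{0..}"]
    by (auto simp: A_def B_def Int_def vimage_def)
  define s where "s x = rt k c * cnj x" for x
  have s: "s x \<in> K" if "x \<in> K" for x
    using that mirror_K rt_power[OF k0] by (simp add: s_def)
  have f_s: "f (s x) = - f x" for x
    unfolding f_def s_def by (rule Im_mirror)
  have "0 < f z"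
    using pos by (simp only: f_def)
  then have sz: "s z \<in> Z" "z \<noteq> s z"
    using mirror_Z[OF z rt_power[OF k0]] f_s[of z] by (auto simp: s_def)
  have on_mirror: "z + x = s z + s x" if "f (z + x) = 0" for x
    using mirror_fixed[of k c "z + x"] that unfolding f_def s_def complex_cnj_add distrib_left by simp
  \<comment> \<open>A point of the cell on the mirror also belongs to the reflected cell, so nesting
    makes it a vertex.\<close>
  have AB_roots: "x ^ k = 1" "s x ^ k = 1" if "x \<in> A \<inter> B" for x
    using that on_mirror[of x] nested[OF z sz, of x "s x"] nested[OF sz(1) z, of "s x" x] sz(2) s
    by (auto simp: A_def B_def)
  \<comment> \<open>The roots of unity sum to 0, so they are not all strictly on the negative side.
    This yields a vertex strictly on the side of the center.\<close>
  have "\<exists>q\<in>V. 0 \<le> f q"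
  proof (rule ccontr)
    assume "\<not> (\<exists>q\<in>V. 0 \<le> f q)"
    then have "(\<Sum>q\<in>V. f q) < (\<Sum>q\<in>V. 0)"
      using V p by (intro sum_strict_mono) (auto simp: V_def not_le)
    moreover have "(\<Sum>q\<in>V. f q) = f (\<Sum>V)"
      by (simp add: f_def sum_distrib_left Im_sum)
    moreover have "\<Sum>V = 0"
      unfolding V_def using k_ge_3 by (intro sum_roots_unity) simp
    ultimately show False
      by (simp add: f_def)
  qed
  then obtain q where q: "q \<in> V" "0 \<le> f q"
    by blast
  have "f (z + q) = f z + f q"
    by (simp add: f_def distrib_left)
  then have q_pos: "0 < f (z + q)"
    using q(2) \<open>0 < f z\<close> by simp
  have pA: "p \<in> A" and qB: "q \<in> B"
    using p q V neg q_pos by (auto simp: A_def B_def V_def)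
  have "A \<inter> B \<noteq> {}"
    using connected_closedD[OF connected_K, of A B] AB pA qB by auto
  then obtain x where x: "x \<in> A \<inter> B"
    by blast
  have "y = x" if y: "y \<in> A \<inter> B" for y
    using common_vertex_unique[OF z sz AB_roots[OF y] AB_roots[OF x]] on_mirror x y
    by (auto simp: A_def B_def)
  then have cut: "A \<inter> B = {x}" "B \<inter> A = {x}"
    using x by blast+
  have xV: "x \<in> V" "x \<noteq> 0"
    using AB_roots[OF x] k0 by (auto simp: V_def power_0_left)
  have transitive: "\<exists>g. g x = v \<and> continuous_on UNIV g \<and> inj g \<and> g ` K = K \<and> g ` V = V"
    if "v \<in> V" for v
  proof -
    define r where "r = v / x"
    have r: "r ^ k = 1" "(1 / r) ^ k = 1" "r \<noteq> 0"
      using that xV k0 by (auto simp: V_def r_def power_divide power_0_left)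
    have "y \<in> (*) r ` K" if "y \<in> K" for y
      using rotate_K[OF that r(2)] r(3) by (intro image_eqI[of _ _ "1 / r * y"]) auto
    then have "(*) r ` K = K"
      using rotate_K r(1) by blast
    moreover have "y \<in> (*) r ` V" if "y \<in> V" for y
      using that r(1,3) by (intro image_eqI[of _ _ "y / r"]) (auto simp: V_def power_divide)
    then have "(*) r ` V = V"
      using r(1) by (auto simp: V_def power_mult_distrib)
    moreover have "r * x = v" "inj ((*) r)"
      using xV r(3) by (simp_all add: r_def inj_on_def)
    moreover have "continuous_on UNIV ((*) r)"
      by (intro continuous_intros)
    ultimately show ?thesis
      by blast
  qed
  show False
  proof (cases "card (A \<inter> V) \<le> card (B \<inter> V)")
    case True
    have "A \<inter> V = {x}"
      using smaller_side_of_cut[OF _ AB(1,2) cut(1) V(1) xV(1) True] AB(3) connected_K transitive by simp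
    then have "p = x"
      using pA p by (auto simp: V_def)
    then show False
      using x neg by (simp add: B_def)
  next
    case False
    have "B \<inter> V = {x}"
      using smaller_side_of_cut[OF _ AB(2,1) cut(2) V(1) xV(1)] AB(3) connected_K transitive False
      by (simp add: Un_commute)
    then have "q = x"
      using qB q by auto
    then show False
      using x q_pos by (simp add: A_def)
  qed
qed

sublocale polygon_cells k Z
proof
  show "p * z \<in> Z" if "z \<in> Z" "p ^ k = 1" for z p
    using mirror_Z[OF mirror_Z[OF that(1), of 1] that(2)] by simp
  show "cnj z \<in> Z" if "z \<in> Z" for z
    using mirror_Z[OF that, of 1] by simp
qed (fact k_ge_3 common_vertex_unique vertices_same_side)+

end

section \<open>The regular polygon\<close>

text \<open>The closure condition is what reflections of a polygon provide. It makes
  \<open>G\<close> closed under multiplication; comparing the product over \<open>G\<close> with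
  that over \<open>x * G\<close> gives \<open>x ^ card G = 1\<close>, and counting finishes.\<close>

lemma roots_of_unity_if_closed:
  fixes G :: "complex set"
  assumes "finite G" "3 \<le> card G" "1 \<in> G" "0 \<notin> G"
    and closed: "\<And>x y t. \<lbrakk>x \<in> G; y \<in> G; t \<in> G; x \<noteq> y\<rbrakk> \<Longrightarrow> x * y / t \<in> G"
  shows "G = {p. p ^ card G = 1}"
proof -
  have nz: "x \<noteq> 0" if "x \<in> G" for x
    using that assms(4) by auto
  have square: "x * x / t \<in> G" if x: "x \<in> G" "t \<in> G" for x t
  proof (cases "t = x")
    case True
    then show ?thesis
      using x nz by simp
  next
    case False
    have "card {x, t} < card G"
      using assms(2) card_insert_le_m1[of 2 "{t}" x] by (simp add: card_insert_if)
    \<comment> \<open>A third element avoids the excluded case of equal factors: the square arises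
      as \<open>x * (x * w / t) / w\<close>.\<close>
    then obtain w where w: "w \<in> G" "w \<noteq> x" "w \<noteq> t"
      by (metis card_mono finite.emptyI finite.insertI insertCI not_less subsetI)
    have "x * w / t \<in> G"
      using closed x w by blast
    moreover have "x * w / t \<noteq> x"
      using nz[OF x(1)] nz[OF x(2)] w(3) by (simp add: field_simps)
    ultimately have "x * (x * w / t) / w \<in> G"
      using closed x w by metis
    then show ?thesis
      using nz[OF w(1)] by simp
  qed
  have mult: "x * y \<in> G" if "x \<in> G" "y \<in> G" for x y
    using closed[OF that assms(3)] square[OF _ assms(3)] that by (cases "x = y") auto
  have "x ^ card G = 1" if x: "x \<in> G" for x
  proof -
    have "inj_on ((*) x) G"
      using nz[OF x] by (auto simp: inj_on_def)
    moreover have "(*) x ` G \<subseteq> G"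
      using mult x by blast
    ultimately have "(*) x ` G = G"
      using assms(1) by (simp add: endo_inj_surj)
    then have "(\<Prod>g\<in>G. g) = (\<Prod>g\<in>G. x * g)"
      using \<open>inj_on ((*) x) G\<close> by (metis (no_types, lifting) prod.reindex_cong)
    also have "\<dots> = x ^ card G * (\<Prod>g\<in>G. g)"
      by (simp add: prod.distrib)
    finally show ?thesis
      using nz assms(1) by (simp add: prod_zero_iff)
  qed
  then have "G \<subseteq> {p. p ^ card G = 1}"
    by blast
  then show ?thesis
    using assms(2) finite_roots_unity[of "card G"] card_roots_unity_eq[of "card G"]
    by (intro card_subset_eq) auto
qed

text \<open>Two different circles of equal radius meet in at most two points. In units of
  \<open>t\<close> these are \<open>- 1 / 2\<close> plus or minus \<open>h\<close> times the
  imaginary unit.\<close>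

lemma translated_circle_points:
  fixes S :: "complex set"
  assumes "3 \<le> card S" and circle: "\<And>x. x \<in> S \<Longrightarrow> norm x = r" "\<And>x. x \<in> S \<Longrightarrow> norm (x + t) = r"
  shows "t = 0"
proof (rule ccontr)
  assume t: "t \<noteq> 0"
  define h where "h = sqrt ((r / norm t)\<^sup>2 - 1 / 4)"
  have "x \<in> {t * Complex (- (1 / 2)) h, t * Complex (- (1 / 2)) (- h)}" if "x \<in> S" for x
  proof -
    define y where "y = x / t"
    have x: "x = t * y"
      using t by (simp add: y_def)
    have "x + t = t * (y + 1)"
      by (simp add: x distrib_left)
    then have "norm y = r / norm t" "norm (y + 1) = r / norm t"
      using circle[OF that] t by (simp_all add: y_def norm_divide norm_mult field_simps)
    then have "(Re y)\<^sup>2 + (Im y)\<^sup>2 = (r / norm t)\<^sup>2" "(Re y + 1)\<^sup>2 + (Im y)\<^sup>2 = (r / norm t)\<^sup>2"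
      using cmod_power2[of y] cmod_power2[of "y + 1"] by simp_all
    then have re: "Re y = - (1 / 2)" and "(Im y)\<^sup>2 = (r / norm t)\<^sup>2 - 1 / 4"
      by (algebra+)
    then have "\<bar>Im y\<bar> = h"
      by (metis h_def real_sqrt_abs)
    then have "y = Complex (- (1 / 2)) h \<or> y = Complex (- (1 / 2)) (- h)"
      using re by (auto simp: complex_eq_iff)
    then show ?thesis
      unfolding x by blast
  qed
  then have "S \<subseteq> {t * Complex (- (1 / 2)) h, t * Complex (- (1 / 2)) (- h)}"
    by blast
  then have "card S \<le> card {t * Complex (- (1 / 2)) h, t * Complex (- (1 / 2)) (- h)}"
    by (intro card_mono) auto
  also have "\<dots> \<le> 2"
    by (simp add: card_insert_if)
  finally show False
    using assms(1) by simp
qed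

lemma bisector_reflection_eq:
  assumes "x \<noteq> y"
  shows "bisector_reflection x y z = midpoint x y - (x - y) / cnj (x - y) * cnj (z - midpoint x y)"
proof -
  define d where "d = x - y"
  define v where "v = z - midpoint x y"
  have d: "d \<noteq> 0" "cnj d \<noteq> 0"
    using assms by (simp_all add: d_def)
  have "complex_of_real (2 * (v \<bullet> d) / (norm d)\<^sup>2) = (v * cnj d + cnj v * d) / (d * cnj d)"
    by (simp add: complex_norm_square[symmetric] complex_eq_iff inner_complex_def mult_ac flip: of_real_power)
  then have "v - (2 * (v \<bullet> d) / (norm d)\<^sup>2) *\<^sub>R d = v - (v * cnj d + cnj v * d) / (d * cnj d) * d"
    by (simp add: scaleR_conv_of_real)
  also have "\<dots> = - (d / cnj d * cnj v)"
    using d by (simp add: field_simps)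
  finally have "midpoint x y + (v - (2 * (v \<bullet> d) / (norm d)\<^sup>2) *\<^sub>R d) = midpoint x y - d / cnj d * cnj v"
    by simp
  then show ?thesis
    unfolding bisector_reflection_def d_def v_def by (simp add: algebra_simps)
qed

text \<open>The bisector of two points equidistant from \<open>b\<close> passes through
  \<open>b\<close>. In this form reflections become multiplications of vertices, since
  \<open>(X - Y) / cnj (X - Y)\<close> is \<open>- X * Y\<close> over the squared radius.\<close>

lemma bisector_reflection_circle:
  assumes "norm X = r" "norm Y = r" "X \<noteq> Y"
  shows "bisector_reflection (b + X) (b + Y) (b + T) = b + X * Y * cnj T / of_real (r\<^sup>2)"
proof -
  have r: "X * cnj X = of_real (r\<^sup>2)" "Y * cnj Y = of_real (r\<^sup>2)"
    using assms by (simp_all add: complex_norm_square[symmetric])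
  have "r \<noteq> 0"
    using assms by auto
  then have nz: "complex_of_real (r\<^sup>2) \<noteq> 0" "X \<noteq> 0" "Y \<noteq> 0"
    using assms by auto
  have "cnj (X - Y) \<noteq> 0"
    using assms(3) by simp
  have "(X - Y) * of_real (r\<^sup>2) = X * (Y * cnj Y) - Y * (X * cnj X)"
    unfolding r by (simp only: left_diff_distrib)
  also have "\<dots> = - (X * Y) * cnj (X - Y)"
    by (simp add: algebra_simps)
  finally have "(X - Y) * of_real (r\<^sup>2) = - (X * Y) * cnj (X - Y)" .
  then have q: "(X - Y) / cnj (X - Y) = - (X * Y) / of_real (r\<^sup>2)"
    using nz \<open>cnj (X - Y) \<noteq> 0\<close> by (simp add: field_simps)
  have mid: "midpoint (b + X) (b + Y) = b + (X + Y) / 2"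
    by (simp add: midpoint_def scaleR_conv_of_real field_simps)
  have "bisector_reflection (b + X) (b + Y) (b + T) =
    b + (X + Y) / 2 + X * Y / of_real (r\<^sup>2) * cnj (T - (X + Y) / 2)"
    using bisector_reflection_eq[of "b + X" "b + Y" "b + T"] assms(3)
    unfolding mid add_diff_cancel_left q by simp
  also have "\<dots> = b + (X + Y) / 2 + X * Y * cnj T / of_real (r\<^sup>2) -
    (X * (Y * cnj Y) / of_real (r\<^sup>2) + Y * (X * cnj X) / of_real (r\<^sup>2)) / 2"
    by (simp add: algebra_simps add_divide_distrib diff_divide_distrib)
  also have "\<dots> = b + X * Y * cnj T / of_real (r\<^sup>2)"
    unfolding r using nz(1) by (simp add: field_simps)
  finally show ?thesis .
qed

section \<open>The attractor and its connectedness\<close>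

context simple_nested_fractal
begin

lemma dist_\<Psi>: "dist (\<Psi> i x) (\<Psi> i y) = dist x y / L"
proof -
  have "\<Psi> i x - \<Psi> i y = (x - y) /\<^sub>R L"
    by (simp add: \<Psi>_def algebra_simps)
  then show ?thesis
    using L_gt_1 by (simp add: dist_norm divide_inverse mult.commute)
qed

lemma \<Psi>_in_K: "\<lbrakk>i \<in> {1..N}; x \<in> K\<rbrakk> \<Longrightarrow> \<Psi> i x \<in> K"
  using K_self_similar by blast

lemma \<Psi>_eq_iff: "\<Psi> i x = \<Psi> i y \<longleftrightarrow> x = y"
  using L_gt_1 by (simp add: \<Psi>_def)

lemma nonpos_if_contracted:
  assumes "m \<le> m / L"
  shows "m \<le> 0"
proof -
  have "m * (L - 1) \<le> 0"
    using assms L_gt_1 by (simp add: field_simps)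
  then show ?thesis
    using L_gt_1 by (simp add: mult_le_0_iff)
qed

text \<open>The largest distance from \<open>K\<close> to \<open>T\<close> is attained at some
  \<open>\<Psi> i y\<close>; contraction bounds it by its own \<open>L\<close>-th part, so it is
  0.\<close>

lemma K_least:
  assumes "closed T" "T \<noteq> {}" "\<And>i x. \<lbrakk>i \<in> {1..N}; x \<in> T\<rbrakk> \<Longrightarrow> \<Psi> i x \<in> T"
  shows "K \<subseteq> T"
proof -
  obtain x where x: "x \<in> K" "\<And>y. y \<in> K \<Longrightarrow> infdist y T \<le> infdist x T"
    using continuous_attains_sup[OF compact_K K_nonempty continuous_on_infdist[OF continuous_on_id]]
    by blast
  obtain i y where i: "i \<in> {1..N}" "y \<in> K" "x = \<Psi> i y"
    using x(1) K_self_similar by blast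
  obtain a where a: "a \<in> T" "infdist y T = dist y a"
    using infdist_attains_inf[OF assms(1,2)] by blast
  have "infdist x T \<le> dist x (\<Psi> i a)"
    using assms(3) a(1) i(1) by (intro infdist_le) auto
  also have "\<dots> = infdist y T / L"
    by (simp add: i(3) dist_\<Psi> a(2))
  also have "\<dots> \<le> infdist x T / L"
    using x(2)[OF i(2)] L_gt_1 by (simp add: divide_right_mono)
  finally have "infdist x T \<le> 0"
    by (rule nonpos_if_contracted)
  then have "infdist y T = 0" if "y \<in> K" for y
    using x(2)[OF that] infdist_nonneg[of y T] by linarith
  then show ?thesis
    using assms(1,2) in_closed_iff_infdist_zero by blast
qed

lemma fixed_point_in_K:
  assumes "i \<in> {1..N}" "\<Psi> i x = x"
  shows "x \<in> K"
proof -
  obtain y where y: "y \<in> K" "infdist x K = dist x y"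
    using infdist_attains_inf[OF compact_imp_closed[OF compact_K] K_nonempty] by blast
  have "dist x y \<le> dist x (\<Psi> i y)"
    using infdist_le[OF \<Psi>_in_K[OF assms(1) y(1)], of x] y(2) by simp
  also have "\<dots> = dist x y / L"
    using dist_\<Psi>[of i x y] assms(2) by simp
  finally have "dist x y \<le> 0"
    by (rule nonpos_if_contracted)
  then show ?thesis
    using y(1) by simp
qed

lemma V0_subset_K: "V0 \<subseteq> K"
  unfolding V0_def fixed_points_def using fixed_point_in_K by blast

lemma finite_V0: "finite V0"
  using k_ge_2 unfolding k_def by (intro card_ge_0_finite) simp

lemma V0_nonempty: "V0 \<noteq> {}"
  using k_ge_2 unfolding k_def by auto

lemma continuous_\<Psi>: "continuous_on S (\<Psi> i)"
  unfolding \<Psi>_def by (intro continuous_intros)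

text \<open>If every cell lay in one part, a path in the connected graph from a cell in
  \<open>A\<close> to a cell in \<open>B\<close> could never leave \<open>A\<close>, as each edge
  stays within one cell.\<close>

lemma split_cell:
  assumes AB: "A \<union> B = K" "A \<inter> B = {}" "A \<noteq> {}" "B \<noteq> {}"
  obtains i where "i \<in> {1..N}" "\<Psi> i ` K \<inter> A \<noteq> {}" "\<Psi> i ` K \<inter> B \<noteq> {}"
proof (rule ccontr)
  note split = that
  assume "\<not> thesis"
  then have "\<Psi> i ` K \<inter> A = {} \<or> \<Psi> i ` K \<inter> B = {}" if "i \<in> {1..N}" for i
    using split[OF that] by blast
  moreover have "\<Psi> i ` K \<subseteq> A \<union> B" if "i \<in> {1..N}" for i
    using AB(1) \<Psi>_in_K[OF that] by blast
  ultimately have whole: "\<Psi> i ` K \<subseteq> A \<or> \<Psi> i ` K \<subseteq> B" if "i \<in> {1..N}" for i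
    using that by blast
  obtain v where v: "v \<in> V0" "v \<in> K"
    using V0_nonempty V0_subset_K by blast
  have cell: "\<exists>i\<in>{1..N}. \<Psi> i ` K \<subseteq> C" if C: "C = A \<or> C = B" "C \<noteq> {}" for C
  proof -
    obtain x where x: "x \<in> C" "x \<in> K"
      using C AB by blast
    then obtain i where "i \<in> {1..N}" "x \<in> \<Psi> i ` K"
      using K_self_similar by blast
    then show ?thesis
      using whole x(1) C(1) AB(2) by blast
  qed
  obtain i j where ij: "i \<in> {1..N}" "j \<in> {1..N}" "\<Psi> i ` K \<subseteq> A" "\<Psi> j ` K \<subseteq> B"
    using cell[of A] cell[of B] AB by blast
  have "(\<Psi> i v, \<Psi> j v) \<in> edges_minus1\<^sup>*"
    using connectivity ij(1,2) v(1) unfolding V_minus1_def by blast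
  then have "\<Psi> j v \<in> A"
  proof (induction rule: rtrancl_induct)
    case base
    then show ?case
      using ij(3) v(2) by blast
  next
    case (step x y)
    then show ?case
      using whole AB(2) unfolding edges_minus1_def by blast
  qed
  then show False
    using ij(4) v(2) AB(2) by blast
qed

text \<open>A separation of \<open>K\<close> splits some cell; blowing this cell up enlarges the gap by the factor \<open>L\<close>.\<close>

lemma connected_K: "connected K"
proof (rule ccontr)
  define separated where "separated d \<longleftrightarrow> (\<exists>A B. closed A \<and> closed B \<and> A \<union> B = K \<and> A \<inter> B = {} \<and>
    A \<noteq> {} \<and> B \<noteq> {} \<and> (\<forall>a\<in>A. \<forall>b\<in>B. d \<le> dist a b))" for d :: real
  assume "\<not> connected K"
  then obtain A B where AB: "closed A" "closed B" "A \<union> B = K" "A \<inter> B = {}" "A \<noteq> {}" "B \<noteq> {}"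
    using connected_closed_set[OF compact_imp_closed[OF compact_K]] by metis
  have "K \<inter> A = A"
    using AB(3) by blast
  then have "compact A"
    using compact_Int_closed[OF compact_K AB(1)] by simp
  then obtain d where d: "0 < d" "separated d"
    using separate_compact_closed[of A B] AB unfolding separated_def by metis
  have blow_up: "separated (L * e)" if e: "separated e" for e
  proof -
    obtain A B where AB: "closed A" "closed B" "A \<union> B = K" "A \<inter> B = {}" "A \<noteq> {}" "B \<noteq> {}"
      "\<forall>a\<in>A. \<forall>b\<in>B. e \<le> dist a b"
      using e unfolding separated_def by blast
    obtain i where i: "i \<in> {1..N}" "\<Psi> i ` K \<inter> A \<noteq> {}" "\<Psi> i ` K \<inter> B \<noteq> {}"
      using split_cell[OF AB(3-6)] by blast
    let ?A = "K \<inter> \<Psi> i -` A" and ?B = "K \<inter> \<Psi> i -` B"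
    have "closed ?A" "closed ?B"
      using continuous_closed_preimage[OF continuous_\<Psi> compact_imp_closed[OF compact_K]] AB(1,2) by auto
    moreover have "?A \<union> ?B = K" "?A \<inter> ?B = {}" "?A \<noteq> {}" "?B \<noteq> {}"
      using AB(3,4) i \<Psi>_in_K by blast+
    moreover have "\<forall>a\<in>?A. \<forall>b\<in>?B. L * e \<le> dist a b"
    proof (intro ballI)
      fix a b assume ab: "a \<in> ?A" "b \<in> ?B"
      have "e \<le> dist a b / L"
        using AB(7) ab by (simp flip: dist_\<Psi>[of i])
      then show "L * e \<le> dist a b"
        using L_gt_1 by (simp add: field_simps)
    qed
    ultimately show ?thesis
      unfolding separated_def by (intro exI[of _ ?A] exI[of _ ?B] conjI) assumption+
  qed
  have sep: "separated (L ^ n * d)" for n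
  proof (induction n)
    case (Suc n)
    then show ?case
      using blow_up[OF Suc] by (simp add: mult.assoc)
  qed (use d in simp)
  obtain M where M: "\<And>x y. \<lbrakk>x \<in> K; y \<in> K\<rbrakk> \<Longrightarrow> dist x y \<le> M"
    using compact_imp_bounded[OF compact_K] unfolding bounded_two_points by blast
  obtain n where "M / d < L ^ n"
    using real_arch_pow[OF L_gt_1] by blast
  then have "M < L ^ n * d"
    using d(1) by (simp add: field_simps)
  moreover obtain A B where "A \<union> B = K" "A \<noteq> {}" "B \<noteq> {}" "\<forall>a\<in>A. \<forall>b\<in>B. L ^ n * d \<le> dist a b"
    using sep[of n] unfolding separated_def by blast
  ultimately show False
    using M by fastforce
qed

section \<open>The vertices as a regular polygon\<close>

abbreviation b0 :: complex
  where "b0 \<equiv> barycenter V0"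

lemma reflection_inj:
  assumes "x \<noteq> y"
  shows "inj (bisector_reflection x y)"
  using assms by (auto simp: inj_on_def bisector_reflection_eq)

lemma finite_V_minus1: "finite V_minus1"
  unfolding V_minus1_def using finite_V0 by auto

lemma N_pos: "{1..N} \<noteq> {}"
  using zero_shift by auto

lemma V_minus1_nonempty: "V_minus1 \<noteq> {}"
  unfolding V_minus1_def using V0_nonempty N_pos by auto

lemma reflection_V_minus1:
  assumes "x \<in> V0" "y \<in> V0" "x \<noteq> y"
  shows "bisector_reflection x y ` V_minus1 = V_minus1"
proof (rule endo_inj_surj[OF finite_V_minus1])
  show "bisector_reflection x y ` V_minus1 \<subseteq> V_minus1"
  proof (intro image_subsetI)
    fix v assume "v \<in> V_minus1"
    then obtain i where i: "i \<in> {1..N}" "v \<in> \<Psi> i ` V0"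
      unfolding V_minus1_def by blast
    obtain j where "j \<in> {1..N}" "bisector_reflection x y ` \<Psi> i ` V0 = \<Psi> j ` V0"
      using symmetry[OF i(1) assms] by blast
    then show "bisector_reflection x y v \<in> V_minus1"
      unfolding V_minus1_def using i(2) by blast
  qed
  show "inj_on (bisector_reflection x y) V_minus1"
    using reflection_inj[OF assms(3)] by (rule inj_on_subset) simp
qed

text \<open>The symmetry assumption speaks about cells, not about \<open>V0\<close>, so the
  barycenter is taken of all their vertices. The reflections permute these, hence it lies on every
  bisector.\<close>

lemma equidistant:
  assumes "x \<in> V0" "y \<in> V0"
  shows "norm (x - barycenter V_minus1) = norm (y - barycenter V_minus1)"
proof (cases "x = y")
  case False
  define d where "d = x - y"
  define m where "m = midpoint x y"
  define n where "n = card V_minus1"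
  have n: "0 < n"
    using finite_V_minus1 V_minus1_nonempty by (simp add: n_def card_gt_0_iff)
  have "d \<noteq> 0"
    using False by (simp add: d_def)
  \<comment> \<open>Summing over the permuted vertices shows that their displacements along
    \<open>d\<close> cancel, so the barycenter is on the bisector.\<close>
  have "(\<Sum>v\<in>V_minus1. v) = (\<Sum>v\<in>V_minus1. bisector_reflection x y v)"
    using sum.reindex[of "bisector_reflection x y" V_minus1 "\<lambda>v. v"] reflection_V_minus1[OF assms False]
      inj_on_subset[OF reflection_inj[OF False]] by simp
  also have "\<dots> = (\<Sum>v\<in>V_minus1. v) - (\<Sum>v\<in>V_minus1. (2 * ((v - m) \<bullet> d) / (norm d)\<^sup>2)) *\<^sub>R d"
    by (simp add: bisector_reflection_def d_def m_def sum_subtractf scaleR_sum_left)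
  finally have "(\<Sum>v\<in>V_minus1. (2 * ((v - m) \<bullet> d) / (norm d)\<^sup>2)) = 0"
    using \<open>d \<noteq> 0\<close> by simp
  then have "2 / (norm d)\<^sup>2 * (\<Sum>v\<in>V_minus1. (v - m) \<bullet> d) = 0"
    by (simp add: sum_distrib_left)
  then have "(\<Sum>v\<in>V_minus1. (v - m)) \<bullet> d = 0"
    using \<open>d \<noteq> 0\<close> by (simp add: inner_sum_left)
  moreover have "(\<Sum>v\<in>V_minus1. (v - m)) = real n *\<^sub>R (barycenter V_minus1 - m)"
    using n by (simp add: sum_subtractf barycenter_def n_def scaleR_conv_of_real right_diff_distrib)
  ultimately have orth: "(barycenter V_minus1 - m) \<bullet> d = 0"
    using n by simp
  define \<beta> where "\<beta> = barycenter V_minus1"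
  have "(norm (x - \<beta>))\<^sup>2 - (norm (y - \<beta>))\<^sup>2 = - 2 * ((\<beta> - m) \<bullet> d)"
    by (simp add: power2_norm_eq_inner m_def d_def midpoint_def inner_diff inner_add inner_commute algebra_simps)
  then have "(norm (x - \<beta>))\<^sup>2 = (norm (y - \<beta>))\<^sup>2"
    using orth by (simp add: \<beta>_def)
  then show ?thesis
    by (simp add: \<beta>_def)
qed simp

text \<open>The center of \<open>complex0 (L *\<^sub>R \<nu> i)\<close> in coordinates with origin \<open>L *\<^sub>R b0\<close> and unit \<open>c\<close>.\<close>

definition cell :: "complex \<Rightarrow> nat \<Rightarrow> complex"
  where "cell c i = of_real L * (\<Psi> i b0 - b0) / c"

lemma \<Psi>_affine: "\<Psi> i (x + y) = \<Psi> i x + y / of_real L"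
  by (simp add: \<Psi>_def scaleR_conv_of_real divide_inverse distrib_left mult.commute)

text \<open>Symmetry equates the vertex sets of two cells; that centers go to centers needs an
  argument. The possible mismatch \<open>t\<close> of the centers would move the reflected vertices,
  at least three, along their circle by a translation.\<close>

lemma reflected_cells:
  assumes k: "3 \<le> k" and xy: "x \<in> V0" "y \<in> V0" "x \<noteq> y" and i: "i \<in> {1..N}"
  defines "\<beta> \<equiv> barycenter V_minus1"
  defines "s \<equiv> \<lambda>t. (x - \<beta>) * (y - \<beta>) * cnj t / of_real ((norm (x - \<beta>))\<^sup>2)"
  shows "\<exists>j\<in>{1..N}. \<Psi> j \<beta> - \<beta> = s (\<Psi> i \<beta> - \<beta>)" and "v \<in> V0 \<Longrightarrow> \<beta> + s (v - \<beta>) \<in> V0"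
proof -
  define r where "r = norm (x - \<beta>)"
  have r: "norm (v - \<beta>) = r" if "v \<in> V0" for v
    unfolding r_def \<beta>_def using equidistant[OF that xy(1)] .
  have "r \<noteq> 0"
    using r[OF xy(1)] r[OF xy(2)] xy(3) by auto
  have s_r: "s t = (x - \<beta>) * (y - \<beta>) * cnj t / of_real (r\<^sup>2)" for t
    by (simp only: s_def r_def)
  have refl: "bisector_reflection x y (\<beta> + t) = \<beta> + s t" for t
    using bisector_reflection_circle[of "x - \<beta>" r "y - \<beta>" \<beta> t] r xy by (simp add: s_r)
  have s_add: "s (a + b) = s a + s b" and s_div: "s (a / of_real L) = s a / of_real L" for a b
    by (simp_all add: s_def distrib_left add_divide_distrib)
  have s_norm: "norm (s a) = norm a" for a
    using r[OF xy(1)] r[OF xy(2)] \<open>r \<noteq> 0\<close>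
    by (simp add: s_r norm_mult norm_divide power2_eq_square)
  obtain j where j: "j \<in> {1..N}" "bisector_reflection x y ` \<Psi> i ` V0 = \<Psi> j ` V0"
    using symmetry[OF i xy] by blast
  define t where "t = of_real L * (\<beta> + s (\<Psi> i \<beta> - \<beta>) - \<Psi> j \<beta>)"
  have L: "complex_of_real L \<noteq> 0"
    using L_gt_1 by simp
  have image: "\<beta> + (s (v - \<beta>) + t) \<in> V0" if "v \<in> V0" for v
  proof -
    have "bisector_reflection x y (\<Psi> i v) \<in> \<Psi> j ` V0"
      using j(2) that by blast
    then obtain v' where v': "v' \<in> V0" "bisector_reflection x y (\<Psi> i v) = \<Psi> j v'"
      by blast
    have \<Psi>_v: "\<Psi> i v = \<beta> + ((\<Psi> i \<beta> - \<beta>) + (v - \<beta>) / of_real L)"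
      using \<Psi>_affine[of i \<beta> "v - \<beta>"] by simp
    have "\<beta> + (s (\<Psi> i \<beta> - \<beta>) + s (v - \<beta>) / of_real L) = \<Psi> j v'"
      using v'(2) unfolding \<Psi>_v refl s_add s_div .
    moreover have "\<Psi> j v' = \<Psi> j \<beta> + (v' - \<beta>) / of_real L"
      using \<Psi>_affine[of j \<beta> "v' - \<beta>"] by simp
    ultimately have "v' = \<beta> + (s (v - \<beta>) + t)"
      using L by (simp add: t_def field_simps)
    then show ?thesis
      using v'(1) by simp
  qed
  have t0: "t = 0"
  proof (rule translated_circle_points)
    have "inj s"
      using \<open>r \<noteq> 0\<close> r[OF xy(1)] r[OF xy(2)] by (auto simp: s_r inj_on_def)
    then have "card ((\<lambda>v. s (v - \<beta>)) ` V0) = card V0"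
      by (intro card_image inj_onI) (auto dest!: injD)
    then show "3 \<le> card ((\<lambda>v. s (v - \<beta>)) ` V0)"
      using k by (simp add: k_def)
    show "norm a = r" if "a \<in> (\<lambda>v. s (v - \<beta>)) ` V0" for a
      using that r s_norm by auto
    show "norm (a + t) = r" if "a \<in> (\<lambda>v. s (v - \<beta>)) ` V0" for a
      using that image r by fastforce
  qed
  show "\<exists>j\<in>{1..N}. \<Psi> j \<beta> - \<beta> = s (\<Psi> i \<beta> - \<beta>)"
  proof (intro bexI[of _ j])
    have "\<beta> + s (\<Psi> i \<beta> - \<beta>) - \<Psi> j \<beta> = 0"
      using t0 L unfolding t_def by (simp only: mult_eq_0_iff simp_thms)
    then show "\<Psi> j \<beta> - \<beta> = s (\<Psi> i \<beta> - \<beta>)"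
      by (simp add: algebra_simps)
  qed (rule j(1))
  show "\<beta> + s (v - \<beta>) \<in> V0" if "v \<in> V0"
    using image[OF that] t0 by simp
qed

text \<open>In units of \<open>c\<close>, with origin at the barycenter of \<open>V_minus1\<close>,
  reflecting \<open>t\<close> in the bisector of \<open>x\<close> and \<open>y\<close> gives
  \<open>x * y / t\<close>. So \<open>roots_of_unity_if_closed\<close> applies.\<close>

lemma regular_polygon:
  assumes k: "3 \<le> k" and w: "w \<in> V0"
  shows "w \<noteq> b0" "b0 = barycenter V_minus1" "V0 = (\<lambda>p. b0 + (w - b0) * p) ` {p. p ^ k = 1}"
proof -
  define \<beta> where "\<beta> = barycenter V_minus1"
  define c where "c = w - \<beta>"
  define G where "G = (\<lambda>v. (v - \<beta>) / c) ` V0"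
  have r: "norm (v - \<beta>) = norm c" if "v \<in> V0" for v
    unfolding c_def \<beta>_def using equidistant[OF that w] .
  have c: "c \<noteq> 0"
  proof
    assume "c = 0"
    then have "V0 \<subseteq> {\<beta>}"
      using r by auto
    then have "card V0 \<le> 1"
      using card_mono[of "{\<beta>}" V0] by simp
    then show False
      using k by (simp add: k_def)
  qed
  have V0_G: "V0 = (\<lambda>g. \<beta> + c * g) ` G"
    using c by (auto simp: G_def image_image)
  have card_G: "card G = k"
    unfolding k_def G_def using c by (intro card_image) (auto simp: inj_on_def)
  have "G = {p. p ^ card G = 1}"
  proof (rule roots_of_unity_if_closed)
    show "finite G"
      using finite_V0 by (simp add: G_def)
    show "3 \<le> card G"
      using k card_G by simp
    show "1 \<in> G"
      unfolding G_def using w c by (intro image_eqI[of _ _ w]) (auto simp: c_def)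
    show "0 \<notin> G"
      using r[of \<beta>] c by (auto simp: G_def)
    fix x y t assume xyt: "x \<in> G" "y \<in> G" "t \<in> G" "x \<noteq> y"
    have in_V0: "\<beta> + c * x \<in> V0" "\<beta> + c * y \<in> V0" "\<beta> + c * t \<in> V0"
      using xyt V0_G by blast+
    obtain i where "i \<in> {1..N}"
      using N_pos by blast
    from reflected_cells(2)[OF k in_V0(1,2) _ this in_V0(3)] xyt(4) c
    have "\<beta> + c * x * (c * y) * cnj (c * t) / of_real ((norm (c * x))\<^sup>2) \<in> V0"
      by (simp add: \<beta>_def)
    moreover have "norm (c * x) = norm (c * t)"
      using r[OF in_V0(1)] r[OF in_V0(3)] by simp
    then have "complex_of_real ((norm (c * x))\<^sup>2) = c * t * cnj (c * t)"
      by (simp only: complex_norm_square)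
    moreover have "t \<noteq> 0"
      using r[OF in_V0(3)] c by auto
    ultimately have "\<beta> + c * (x * y / t) \<in> V0"
      using c by (simp add: field_simps)
    then show "x * y / t \<in> G"
      unfolding G_def using c by (intro image_eqI[of _ _ "\<beta> + c * (x * y / t)"]) auto
  qed
  then have V0: "V0 = (\<lambda>p. \<beta> + c * p) ` {p. p ^ k = 1}"
    using V0_G card_G by simp
  have "(\<Sum>v\<in>V0. v) = (\<Sum>p | p ^ k = 1. \<beta> + c * p)"
    unfolding V0 using c by (subst sum.reindex) (auto simp: inj_on_def)
  also have "\<dots> = of_nat k * \<beta> + c * \<Sum>{p. p ^ k = 1}"
    using k card_roots_unity_eq[of k] by (simp add: sum.distrib sum_distrib_left)
  also have "\<Sum>{p::complex. p ^ k = 1} = 0"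
    using k by (intro sum_roots_unity) simp
  finally have "b0 = \<beta>"
    using k by (simp add: barycenter_def scaleR_conv_of_real flip: k_def)
  then show "w \<noteq> b0" "b0 = barycenter V_minus1" "V0 = (\<lambda>p. b0 + (w - b0) * p) ` {p. p ^ k = 1}"
    using c V0 by (auto simp: c_def \<beta>_def)
qed

end

section \<open>Passage to normalized coordinates\<close>

locale fractal_with_base = simple_nested_fractal +
  fixes c :: complex
  assumes k_ge_3: "3 \<le> k" and base: "b0 + c \<in> V0"
begin

lemma k_pos: "0 < k"
  using k_ge_3 by simp

lemma c_nonzero: "c \<noteq> 0"
  using regular_polygon(1)[OF k_ge_3 base] by simp

lemma V0_eq: "V0 = (\<lambda>p. b0 + c * p) ` {p. p ^ k = 1}"
  using regular_polygon(3)[OF k_ge_3 base] by simp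

lemma V0_cases:
  assumes "x \<in> V0"
  obtains p where "x = b0 + c * p" "p ^ k = 1"
proof -
  have "x \<in> (\<lambda>p. b0 + c * p) ` {p. p ^ k = 1}"
    using assms by (rule back_subst[OF _ V0_eq])
  then show thesis
    using that by blast
qed

lemma in_V0_iff: "b0 + c * p \<in> V0 \<longleftrightarrow> p ^ k = 1"
  using c_nonzero by (subst V0_eq) auto

abbreviation cells :: "complex set"
  where "cells \<equiv> cell c ` {1..N}"

lemma \<Psi>_cell: "\<Psi> i (b0 + c * x) = b0 + c * ((x + cell c i) / of_real L)"
proof -
  have "c * cell c i / of_real L = \<Psi> i b0 - b0"
    using c_nonzero L_gt_1 by (simp add: cell_def)
  then show ?thesis
    by (simp add: \<Psi>_affine distrib_left add_divide_distrib)
qed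

text \<open>A bisector reflection needs two distinct vertices. This lets every mirror of the
  dihedral group arise as such a bisector; for \<open>p = 1\<close> a root other than 1 and -1 is
  paired with its inverse.\<close>

lemma two_roots:
  assumes "p ^ k = 1"
  obtains x y :: complex where "x ^ k = 1" "y ^ k = 1" "x \<noteq> y" "x * y = p"
proof (cases "p = 1")
  case True
  have "card {1, - 1 :: complex} < card {p::complex. p ^ k = 1}"
    using k_ge_3 card_roots_unity_eq[OF k_pos] by (simp add: card_insert_if)
  then have "\<not> {p::complex. p ^ k = 1} \<subseteq> {1, - 1}"
    using card_mono[of "{1, - 1 :: complex}"] by (meson finite.emptyI finite.insertI not_less)
  then obtain x :: complex where x: "x ^ k = 1" "x \<noteq> 1" "x \<noteq> - 1"
    by blast
  have "x \<noteq> 0"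
    using x(1) k_pos by (auto simp: power_0_left)
  moreover have "x * x \<noteq> 1"
    using x square_eq_1_iff by auto
  ultimately show thesis
    using x True by (intro that[of x "1 / x"]) (auto simp: power_divide field_simps)
next
  case False
  then show thesis
    using assms by (intro that[of p 1]) auto
qed

lemma mirror_cell:
  assumes "i \<in> {1..N}" "p ^ k = 1"
  obtains j where "j \<in> {1..N}" "cell c j = p * cnj (cell c i)"
proof -
  obtain x y where xy: "x ^ k = 1" "y ^ k = 1" "x \<noteq> y" "x * y = p"
    using two_roots[OF assms(2)] by blast
  have "b0 + c * x \<in> V0" "b0 + c * y \<in> V0" "b0 + c * x \<noteq> b0 + c * y"
    using xy c_nonzero in_V0_iff by auto
  from reflected_cells(1)[OF k_ge_3 this assms(1), folded regular_polygon(2)[OF k_ge_3 base]]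
  obtain j where j: "j \<in> {1..N}"
    "\<Psi> j b0 - b0 = c * x * (c * y) * cnj (\<Psi> i b0 - b0) / of_real ((norm (c * x))\<^sup>2)"
    by auto
  define f where "f = cnj (\<Psi> i b0 - b0)"
  have "norm (c * x) = norm c"
    using norm_root_of_unity[OF k_pos xy(1)] by (simp add: norm_mult)
  then have \<Psi>_j: "\<Psi> j b0 - b0 = c * (x * y) * (c * f) / (c * cnj c)"
    using j(2) by (simp only: complex_norm_square f_def mult_ac)
  have "cnj (cell c i) = of_real L * f / cnj c"
    by (simp add: cell_def f_def)
  then have "cell c j = x * y * cnj (cell c i)"
    using c_nonzero unfolding cell_def[of c j] \<Psi>_j by (simp add: field_simps)
  then show thesis
    using that j(1) xy(4) by blast
qed

text \<open>The reflection turns each map \<open>\<Psi> i\<close> into some \<open>\<Psi> j\<close>,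
  so the preimage of \<open>K\<close> is invariant under all maps and contains \<open>K\<close> by
  \<open>K_least\<close>.\<close>

lemma mirror_K:
  assumes "b0 + c * x \<in> K" "p ^ k = 1"
  shows "b0 + c * (p * cnj x) \<in> K"
proof -
  define s where "s y = b0 + c * (p * cnj ((y - b0) / c))" for y
  have p: "p * cnj p = 1"
    using norm_root_of_unity[OF k_pos assms(2)] by (simp flip: complex_norm_square)
  have s: "s (b0 + c * y) = b0 + c * (p * cnj y)" for y
    using c_nonzero by (simp add: s_def)
  have ss: "s (s y) = y" for y
  proof -
    have "s (s y) = b0 + c * (p * cnj p * ((y - b0) / c))"
      unfolding s_def[of y] s by simp
    then show ?thesis
      using p c_nonzero by simp
  qed
  have "K \<subseteq> s -` K"
  proof (rule K_least)
    show "closed (s -` K)"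
      unfolding s_def using compact_imp_closed[OF compact_K] c_nonzero
      by (intro continuous_closed_vimage) (auto intro!: continuous_intros)
    show "s -` K \<noteq> {}"
      using K_nonempty ss by (metis empty_iff equals0I vimageI2)
    fix i x assume i: "i \<in> {1..N}" and "x \<in> s -` K"
    define \<xi> where "\<xi> = (x - b0) / c"
    have x: "x = b0 + c * \<xi>"
      using c_nonzero by (simp add: \<xi>_def)
    obtain j where j: "j \<in> {1..N}" "cell c j = p * cnj (cell c i)"
      using mirror_cell[OF i assms(2)] by blast
    have "s (\<Psi> i x) = \<Psi> j (s x)"
      unfolding x \<Psi>_cell s j(2) by (simp add: distrib_left add_divide_distrib)
    then show "\<Psi> i x \<in> s -` K"
      using \<Psi>_in_K[OF j(1)] \<open>x \<in> s -` K\<close> by simp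
  qed
  then show ?thesis
    using assms(1) s by auto
qed

sublocale normalized_fractal k L "(\<lambda>x. b0 + c * x) -` K" cells
proof
  show "closed ((\<lambda>x. b0 + c * x) -` K)"
    using compact_imp_closed[OF compact_K]
    by (intro continuous_closed_vimage) (auto intro!: continuous_intros)
  have "(\<lambda>x. b0 + c * x) -` K = (\<lambda>y. (y - b0) / c) ` K"
    using c_nonzero by (auto intro!: image_eqI[of _ _ "b0 + c * _"])
  then show "connected ((\<lambda>x. b0 + c * x) -` K)"
    using connected_K c_nonzero by (auto intro!: connected_continuous_image continuous_intros)
  show "p \<in> (\<lambda>x. b0 + c * x) -` K" if "p ^ k = 1" for p
    using that in_V0_iff V0_subset_K by auto
  show "p * cnj x \<in> (\<lambda>x. b0 + c * x) -` K" if "x \<in> (\<lambda>x. b0 + c * x) -` K" "p ^ k = 1" for x p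
    using mirror_K that by simp
  show "p * cnj z \<in> cells" if "z \<in> cells" "p ^ k = 1" for z p
  proof -
    obtain i where i: "i \<in> {1..N}" "z = cell c i"
      using \<open>z \<in> cells\<close> by blast
    obtain j where "j \<in> {1..N}" "cell c j = p * cnj (cell c i)"
      using mirror_cell[OF i(1) \<open>p ^ k = 1\<close>] by blast
    then show ?thesis
      unfolding i(2) by (metis imageI)
  qed
  show "(x + z) / of_real L \<in> (\<lambda>x. b0 + c * x) -` K" if "x \<in> (\<lambda>x. b0 + c * x) -` K" "z \<in> cells" for x z
  proof -
    obtain i where i: "i \<in> {1..N}" "z = cell c i"
      using \<open>z \<in> cells\<close> by blast
    have "\<Psi> i (b0 + c * x) \<in> K"
      using \<Psi>_in_K[OF i(1)] that(1) by simp
    then show ?thesis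
      unfolding i(2) \<Psi>_cell by simp
  qed
  show "of_real (L - 1) * p \<in> cells" if "p ^ k = 1" for p
  proof -
    \<comment> \<open>Being an essential fixed point, the vertex is fixed by some map; solving the
      fixed point equation gives the center of that cell.\<close>
    have "b0 + c * p \<in> fixed_points"
      using in_V0_iff that unfolding V0_def by blast
    then obtain i where i: "i \<in> {1..N}" "\<Psi> i (b0 + c * p) = b0 + c * p"
      unfolding fixed_points_def by blast
    have "c * ((p + cell c i) / of_real L) = c * p"
      using i(2) unfolding \<Psi>_cell by (simp only: add_left_cancel)
    then have "(p + cell c i) / of_real L = p"
      using c_nonzero by (simp only: mult_cancel_left simp_thms)
    then have "cell c i = of_real (L - 1) * p"
      using L_gt_1 by (simp add: field_simps)
    then show ?thesis
      using i(1) by (metis imageI)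
  qed
  show "x ^ k = 1"
    if cells: "z \<in> cells" "z' \<in> cells" "z \<noteq> z'"
      and x: "x \<in> (\<lambda>x. b0 + c * x) -` K" "x' \<in> (\<lambda>x. b0 + c * x) -` K" "z + x = z' + x'" for z z' x x'
  proof -
    obtain i j where ij: "i \<in> {1..N}" "j \<in> {1..N}" "z = cell c i" "z' = cell c j"
      using cells by blast
    then have "i \<noteq> j"
      using cells(3) by blast
    have "\<Psi> i (b0 + c * x) = \<Psi> j (b0 + c * x')"
      using x(3) unfolding ij(3,4) \<Psi>_cell by (simp only: add.commute)
    then have "\<Psi> i (b0 + c * x) \<in> \<Psi> i ` K \<inter> \<Psi> j ` K"
      using x(1,2) by (metis IntI imageI vimageD)
    then have "\<Psi> i (b0 + c * x) \<in> \<Psi> i ` V0"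
      using nesting[OF ij(1,2) \<open>i \<noteq> j\<close>] by blast
    then show ?thesis
      using \<Psi>_eq_iff in_V0_iff by auto
  qed
qed (fact k_ge_3 L_gt_1)+

end

section \<open>Spreading a labeling over the unbounded fractal\<close>

lemma (in similitude_system) well_labelable_if_GLP:
  assumes "GLP A"
  shows "well_labelable A D"
proof -
  obtain l where l: "l \<in> V0_infinity \<rightarrow> A" "bij_betw l V0 A"
    "\<forall>\<tau>\<in>shifts0. \<exists>R\<in>rotations0. \<forall>v\<in>vertices0 \<tau>. l v = l (R (v - \<tau>))"
    using assms unfolding GLP_def by blast
  have "l \<in> (\<Union>\<tau>\<in>{\<tau> \<in> shifts0. complex0 \<tau> \<in> D}. vertices0 \<tau>) \<rightarrow> A"
    using l(1) unfolding V0_infinity_def by blast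
  then show ?thesis
    unfolding well_labelable_def using l(2,3) by (intro exI[of _ l]) blast
qed

context fractal_with_base
begin

text \<open>The centers of the 0-complexes given by \<open>J\<close> shift digits, relative to the
  center of \<open>K_level J\<close> and in units of \<open>c\<close>. The last summand selects the
  coarsest block.\<close>

primrec level :: "nat \<Rightarrow> complex set"
  where "level 0 = {0}"
  | "level (Suc J) = {y + of_real (L ^ J) * z | y z. y \<in> level J \<and> z \<in> cells}"

definition level_vertices :: "nat \<Rightarrow> complex set"
  where "level_vertices J = {y + p | y p. y \<in> level J \<and> p ^ k = 1}"

lemma level_rotate:
  assumes "p ^ k = 1"
  shows "y \<in> level J \<Longrightarrow> p * y \<in> level J"
proof (induction J arbitrary: y)
  case (Suc J)
  then obtain y' z where y: "y = y' + of_real (L ^ J) * z" "y' \<in> level J" "z \<in> cells"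
    by auto
  have "p * y = p * y' + of_real (L ^ J) * (p * z)"
    by (simp add: y(1) distrib_left)
  then show ?case
    using Suc.IH[OF y(2)] rotate[OF y(3) assms] by auto
qed simp

lemma L_power_nonzero: "complex_of_real (L ^ J) \<noteq> 0"
  using L_gt_1 by simp

lemma level_in_K:
  assumes "x \<in> (\<lambda>x. b0 + c * x) -` K"
  shows "y \<in> level J \<Longrightarrow> (y + x) / of_real (L ^ J) \<in> (\<lambda>x. b0 + c * x) -` K"
proof (induction J arbitrary: y)
  case (Suc J)
  then obtain y' z where y: "y = y' + of_real (L ^ J) * z" "y' \<in> level J" "z \<in> cells"
    by auto
  have "(y + x) / of_real (L ^ Suc J) = ((y' + x) / of_real (L ^ J) + z) / of_real L"
    using L_power_nonzero[of J] L_gt_1 unfolding y(1) by (simp add: field_simps)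
  then show ?case
    using self_similar[OF Suc.IH[OF y(2)] y(3)] by simp
qed (use assms in simp)

lemma touching_level_vertices:
  assumes "z \<in> cells" "z' \<in> cells" "z \<noteq> z'" "v \<in> level_vertices J" "v' \<in> level_vertices J"
    and "v + of_real (L ^ J) * z = v' + of_real (L ^ J) * z'"
  shows "(v / of_real (L ^ J)) ^ k = 1"
proof -
  have "x / of_real (L ^ J) \<in> (\<lambda>x. b0 + c * x) -` K" if "x \<in> level_vertices J" for x
    using that level_in_K[OF roots_in_K] unfolding level_vertices_def by blast
  moreover have "z + v / of_real (L ^ J) = z' + v' / of_real (L ^ J)"
    using assms(6) L_power_nonzero[of J] by (simp add: field_simps)
  ultimately show ?thesis
    using nested[OF assms(1-3)] assms(4,5) by blast
qed

text \<open>Locates a block containing \<open>x\<close>, rotates the relative position by the label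
  of the block and continues inside. A vertex may lie in several blocks; \<open>spread_Suc\<close>
  shows that the choice does not matter.\<close>

primrec spread :: "(complex \<Rightarrow> complex) \<Rightarrow> nat \<Rightarrow> complex \<Rightarrow> complex"
  where "spread U 0 x = x"
  | "spread U (Suc J) x =
      (let z = SOME z. z \<in> cells \<and> x - of_real (L ^ J) * z \<in> level_vertices J
       in spread U J (U z * (x - of_real (L ^ J) * z)))"

text \<open>Distinct blocks meet only in corners, by \<open>touching_level_vertices\<close>, and at
  a common corner the compatibility of \<open>U\<close> makes both rotated positions equal.\<close>

lemma spread_Suc:
  assumes U: "well_labels k cells U" and "z \<in> cells" "v \<in> level_vertices J"
  shows "spread U (Suc J) (v + of_real (L ^ J) * z) = spread U J (U z * v)"
proof -
  define x where "x = v + of_real (L ^ J) * z"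
  define z' where "z' = (SOME z. z \<in> cells \<and> x - of_real (L ^ J) * z \<in> level_vertices J)"
  define v' where "v' = x - of_real (L ^ J) * z'"
  have "z \<in> cells \<and> x - of_real (L ^ J) * z \<in> level_vertices J"
    using assms(2,3) by (simp add: x_def)
  then have "z' \<in> cells \<and> x - of_real (L ^ J) * z' \<in> level_vertices J"
    unfolding z'_def by (rule someI)
  then have z': "z' \<in> cells" "v' \<in> level_vertices J"
    unfolding v'_def by blast+
  have "U z * v = U z' * v'"
  proof (cases "z = z'")
    case True
    then show ?thesis
      by (simp add: v'_def x_def)
  next
    case False
    have eq: "v + of_real (L ^ J) * z = v' + of_real (L ^ J) * z'"
      by (simp add: v'_def x_def)
    have "z + v / of_real (L ^ J) = z' + v' / of_real (L ^ J)"
      using eq L_power_nonzero[of J] by (simp add: field_simps)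
    from well_labelsD(2)[OF U assms(2) z'(1) _ _ this]
    have "U z * (v / of_real (L ^ J)) = U z' * (v' / of_real (L ^ J))"
      using touching_level_vertices[OF assms(2) z'(1) False assms(3) z'(2) eq]
        touching_level_vertices[OF z'(1) assms(2) False[symmetric] z'(2) assms(3) eq[symmetric]] by blast
    then show ?thesis
      using L_power_nonzero[of J] by (simp only: times_divide_eq_right divide_cancel_right simp_thms)
  qed
  then show ?thesis
    unfolding x_def[symmetric] spread.simps Let_def z'_def[symmetric] v'_def[symmetric]
    by (simp only:)
qed

text \<open>Each level contributes one rotation; their product is the rotation carried by the
  0-complex.\<close>

lemma spread_rotates_labels:
  assumes U: "well_labels k cells U"
  shows "y \<in> level J \<Longrightarrow> \<exists>u. u ^ k = 1 \<and> (\<forall>p. p ^ k = 1 \<longrightarrow> spread U J (y + p) = u * p)"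
proof (induction J arbitrary: y)
  case 0
  then show ?case
    by (intro exI[of _ 1]) auto
next
  case (Suc J)
  then obtain y' z where y: "y = y' + of_real (L ^ J) * z" "y' \<in> level J" "z \<in> cells"
    by auto
  note Uz = well_labelsD(1)[OF U y(3)]
  obtain u where u: "u ^ k = 1" "\<And>p. p ^ k = 1 \<Longrightarrow> spread U J (U z * y' + p) = u * p"
    using Suc.IH[OF level_rotate[OF Uz y(2)]] by blast
  show ?case
  proof (intro exI[of _ "u * U z"] conjI allI impI)
    show "(u * U z) ^ k = 1"
      using u(1) Uz by (simp add: power_mult_distrib)
    fix p :: complex assume p: "p ^ k = 1"
    have "y + p = (y' + p) + of_real (L ^ J) * z"
      by (simp add: y(1))
    moreover have "y' + p \<in> level_vertices J"
      using y(2) p unfolding level_vertices_def by blast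
    ultimately have "spread U (Suc J) (y + p) = spread U J (U z * (y' + p))"
      using spread_Suc[OF U y(3)] by metis
    also have "\<dots> = u * (U z * p)"
      using u(2)[of "U z * p"] p Uz by (simp add: power_mult_distrib distrib_left)
    finally show "spread U (Suc J) (y + p) = u * U z * p"
      by (simp add: mult.assoc)
  qed
qed

definition coord :: "nat \<Rightarrow> complex \<Rightarrow> complex"
  where "coord J x = (x - of_real (L ^ J) * b0) / c"

lemma cell_eq: "cell c i = (b0 + of_real L * \<nu> i - of_real L * b0) / c"
proof -
  have "\<Psi> i b0 = b0 / of_real L + \<nu> i"
    by (simp add: \<Psi>_def scaleR_conv_of_real divide_inverse mult.commute)
  then have "of_real L * (\<Psi> i b0 - b0) = b0 + of_real L * \<nu> i - of_real L * b0"
    using L_gt_1 by (simp add: right_diff_distrib distrib_left)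
  then show ?thesis
    by (simp add: cell_def)
qed

lemma coord_shift:
  assumes "\<And>j. j \<in> {1..J} \<Longrightarrow> \<iota> j \<in> {1..N}"
  shows "coord J (b0 + (\<Sum>j=1..J. L ^ j *\<^sub>R \<nu> (\<iota> j))) \<in> level J"
  using assms
proof (induction J)
  case 0
  then show ?case
    by (simp add: coord_def)
next
  case (Suc J)
  have "coord (Suc J) (b0 + (\<Sum>j=1..Suc J. L ^ j *\<^sub>R \<nu> (\<iota> j))) =
    coord J (b0 + (\<Sum>j=1..J. L ^ j *\<^sub>R \<nu> (\<iota> j))) + of_real (L ^ J) * cell c (\<iota> (Suc J))"
    by (simp add: coord_def cell_eq scaleR_conv_of_real diff_divide_distrib add_divide_distrib algebra_simps)
  moreover have "cell c (\<iota> (Suc J)) \<in> cells"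
    using Suc.prems[of "Suc J"] by auto
  moreover have "coord J (b0 + (\<Sum>j=1..J. L ^ j *\<^sub>R \<nu> (\<iota> j))) \<in> level J"
    using Suc by auto
  ultimately show ?case
    by auto
qed

lemma coord_add: "coord J (x + c * p) = coord J x + p"
  using c_nonzero by (simp add: coord_def add_divide_distrib diff_divide_distrib)

text \<open>The cell with shift 0 embeds each level into the next. If its label is 1, the embedding
  introduces no rotation and the labels of larger levels extend those of smaller ones.\<close>

lemma spread_coord_mono:
  assumes U: "well_labels k cells U" and z: "\<nu> i = 0" "i \<in> {1..N}" "U (cell c i) = 1"
    and x: "coord J x \<in> level_vertices J" and "J \<le> J'"
  shows "coord J' x \<in> level_vertices J' \<and> spread U J' (coord J' x) = spread U J (coord J x)"
  using \<open>J \<le> J'\<close>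
proof (induction rule: dec_induct)
  case base
  then show ?case
    using x by simp
next
  case (step n)
  have eq: "coord (Suc n) x = coord n x + of_real (L ^ n) * cell c i"
    using z(1) by (simp add: coord_def cell_eq diff_divide_distrib add_divide_distrib algebra_simps)
  have cell: "cell c i \<in> cells"
    using z(2) by blast
  obtain y p where y: "coord n x = y + p" "y \<in> level n" "p ^ k = 1"
    using step.IH unfolding level_vertices_def by blast
  have "coord (Suc n) x = (y + of_real (L ^ n) * cell c i) + p"
    by (simp add: eq y(1))
  moreover have "y + of_real (L ^ n) * cell c i \<in> level (Suc n)"
    using y(2) cell by auto
  ultimately have "coord (Suc n) x \<in> level_vertices (Suc n)"
    using y(3) unfolding level_vertices_def by blast
  moreover have "spread U (Suc n) (coord (Suc n) x) = spread U n (coord n x)"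
    unfolding eq using spread_Suc[OF U cell] step.IH z(3) by simp
  ultimately show ?case
    using step.IH by simp
qed

lemma rotations0_root:
  assumes "u ^ k = 1"
  shows "(\<lambda>x. b0 + u * (x - b0)) \<in> rotations0"
proof -
  have "norm u = 1"
    using norm_root_of_unity[OF k_pos assms] .
  then obtain t where t: "u = cis t"
    using rcis_cmod_Arg[of u] unfolding rcis_def by (metis mult_1 of_real_1)
  have "(\<lambda>x. b0 + u * (x - b0)) ` V0 = V0"
  proof (intro set_eqI iffI)
    fix x assume "x \<in> (\<lambda>x. b0 + u * (x - b0)) ` V0"
    then obtain y where "y \<in> V0" "x = b0 + u * (y - b0)"
      by blast
    then obtain p where "x = b0 + c * (u * p)" "p ^ k = 1"
      using V0_cases[of y] by (metis add_diff_cancel_left' mult.left_commute)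
    then show "x \<in> V0"
      using in_V0_iff assms by (simp add: power_mult_distrib)
  next
    fix x assume "x \<in> V0"
    then obtain p where p: "x = b0 + c * p" "p ^ k = 1"
      by (rule V0_cases)
    have "u \<noteq> 0"
      using assms k_pos by (auto simp: power_0_left)
    then have "x = b0 + u * (b0 + c * (p / u) - b0)"
      by (simp add: p(1))
    moreover have "b0 + c * (p / u) \<in> V0"
      unfolding in_V0_iff using assms p(2) by (simp add: power_divide)
    ultimately show "x \<in> (\<lambda>x. b0 + u * (x - b0)) ` V0"
      by blast
  qed
  then show ?thesis
    unfolding rotations0_def t by blast
qed

theorem GLP_if_well_labels:
  fixes A :: "'l set"
  assumes "well_labels k cells U" "finite A" "card A = k"
  shows "GLP A"
proof -
  obtain i0 where i0: "i0 \<in> {1..N}" "\<nu> i0 = 0"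
    using zero_shift by blast
  define a where "a = U (cell c i0)"
  have a: "a ^ k = 1"
    unfolding a_def using i0(1) by (intro well_labelsD(1)[OF assms(1)]) blast
  then have "a \<noteq> 0"
    using k_pos by (auto simp: power_0_left)
  \<comment> \<open>Dividing by the label of the cell with shift 0 gives that cell the label 1, as
    needed for consistency between levels.\<close>
  define U' where "U' z = U z / a" for z
  have U': "well_labels k cells U'" "U' (cell c i0) = 1"
  proof -
    show "well_labels k cells U'"
      unfolding well_labels_def
    proof (intro conjI ballI allI impI)
      show "U' z ^ k = 1" if "z \<in> cells" for z
        using well_labelsD(1)[OF assms(1) that] a by (simp add: U'_def power_divide)
      show "U' z * p = U' z' * q"
        if "z \<in> cells" "z' \<in> cells" "p ^ k = 1" "q ^ k = 1" "z + p = z' + q" for z z' p q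
        using well_labelsD(2)[OF assms(1) that] by (simp add: U'_def)
    qed
    show "U' (cell c i0) = 1"
      using \<open>a \<noteq> 0\<close> by (simp add: U'_def a_def)
  qed
  \<comment> \<open>The value is the same at every level that contains the vertex; the least one
    merely selects a level.\<close>
  define g where "g x = spread U' (LEAST J. coord J x \<in> level_vertices J)
    (coord (LEAST J. coord J x \<in> level_vertices J) x)" for x
  have g_eq: "g x = spread U' J (coord J x)" if "coord J x \<in> level_vertices J" for J x
    unfolding g_def
    using spread_coord_mono[OF U'(1) i0(2,1) U'(2) LeastI[of "\<lambda>J. coord J x \<in> level_vertices J", OF that]
        Least_le[of "\<lambda>J. coord J x \<in> level_vertices J", OF that]] by simp
  have g_V0: "g (b0 + c * p) = p" if "p ^ k = 1" for p
  proof -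
    have "coord 0 (b0 + c * p) = p"
      using c_nonzero by (simp add: coord_def)
    then show ?thesis
      using g_eq[of 0 "b0 + c * p"] that by (simp add: level_vertices_def)
  qed
  have g_shift: "\<exists>u. u ^ k = 1 \<and> (\<forall>p. p ^ k = 1 \<longrightarrow> g (b0 + c * p + \<tau>) = u * p)" if shift: "\<tau> \<in> shifts0" for \<tau>
  proof -
    obtain J \<iota> where \<tau>: "\<And>j. j \<in> {1..J} \<Longrightarrow> \<iota> j \<in> {1..N}" "\<tau> = (\<Sum>j=1..J. L ^ j *\<^sub>R \<nu> (\<iota> j))"
      using shift unfolding shifts0_def by blast
    have y: "coord J (b0 + \<tau>) \<in> level J"
      unfolding \<tau>(2) using \<tau>(1) by (rule coord_shift)
    obtain u where u: "u ^ k = 1" "\<And>p. p ^ k = 1 \<Longrightarrow> spread U' J (coord J (b0 + \<tau>) + p) = u * p"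
      using spread_rotates_labels[OF U'(1) y] by blast
    have "g (b0 + c * p + \<tau>) = u * p" if p: "p ^ k = 1" for p
    proof -
      have eq: "coord J (b0 + c * p + \<tau>) = coord J (b0 + \<tau>) + p"
        using coord_add[of J "b0 + \<tau>" p] by (simp add: add_ac)
      then have "coord J (b0 + c * p + \<tau>) \<in> level_vertices J"
        unfolding level_vertices_def using y p by blast
      then have "g (b0 + c * p + \<tau>) = spread U' J (coord J (b0 + c * p + \<tau>))"
        by (rule g_eq)
      then show ?thesis
        using eq u(2)[OF p] by simp
    qed
    then show ?thesis
      using u(1) by blast
  qed
  obtain l0 where l0: "bij_betw l0 V0 A"
    using finite_same_card_bij[OF finite_V0 assms(2)] assms(3) by (auto simp: k_def)
  \<comment> \<open>\<open>g\<close> assigns to each vertex a root of unity, that is, the vertex of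
    \<open>V0\<close> whose label it inherits.\<close>
  define l where "l x = l0 (b0 + c * g x)" for x
  have l_V0: "l x = l0 x" if "x \<in> V0" for x
    using V0_cases[OF that] g_V0 by (metis l_def)
  have V0_vertex: "b0 + c * p \<in> V0" if "p ^ k = 1" for p
    using that in_V0_iff by blast
  have vertices0_eq: "vertices0 \<tau> = (\<lambda>p. b0 + c * p + \<tau>) ` {p. p ^ k = 1}" for \<tau>
  proof -
    have "vertices0 \<tau> = (\<lambda>x. x + \<tau>) ` (\<lambda>p. b0 + c * p) ` {p. p ^ k = 1}"
      unfolding vertices0_def by (rule arg_cong[OF V0_eq])
    then show ?thesis
      by (simp only: image_image)
  qed
  show ?thesis
    unfolding GLP_def
  proof (intro exI[of _ l] conjI ballI)
    show "l \<in> V0_infinity \<rightarrow> A"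
    proof
      fix x assume "x \<in> V0_infinity"
      then obtain \<tau> p where x: "\<tau> \<in> shifts0" "x = b0 + c * p + \<tau>" "p ^ k = 1"
        unfolding V0_infinity_def vertices0_eq by blast
      then obtain u where "u ^ k = 1" "g x = u * p"
        using g_shift by blast
      then have "b0 + c * g x \<in> V0"
        using x(3) by (simp add: V0_vertex power_mult_distrib)
      then show "l x \<in> A"
        unfolding l_def using bij_betwE[OF l0] by blast
    qed
    show "bij_betw l V0 A"
      using l0 bij_betw_cong[of V0 l l0 A] l_V0 by blast
    fix \<tau> assume "\<tau> \<in> shifts0"
    then obtain u where u: "u ^ k = 1" "\<And>p. p ^ k = 1 \<Longrightarrow> g (b0 + c * p + \<tau>) = u * p"
      using g_shift by blast
    show "\<exists>R\<in>rotations0. \<forall>v\<in>vertices0 \<tau>. l v = l (R (v - \<tau>))"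
    proof (intro bexI[of _ "\<lambda>x. b0 + u * (x - b0)"] ballI)
      fix v assume "v \<in> vertices0 \<tau>"
      then obtain p where p: "v = b0 + c * p + \<tau>" "p ^ k = 1"
        unfolding vertices0_eq by blast
      have "b0 + c * (u * p) \<in> V0"
        using u(1) p(2) by (simp add: V0_vertex power_mult_distrib)
      then have "l (b0 + c * (u * p)) = l0 (b0 + c * (u * p))"
        by (rule l_V0)
      then show "l v = l (b0 + u * (v - \<tau> - b0))"
        using u(2)[OF p(2)] by (simp add: l_def p(1) mult_ac)
    qed (rule rotations0_root[OF u(1)])
  qed
qed

section \<open>Slices in normalized coordinates\<close>

lemma barycenter_vertices0: "barycenter (vertices0 \<tau>) = b0 + \<tau>"
proof -
  have "card (vertices0 \<tau>) = k"
    unfolding vertices0_def k_def by (intro card_image) (auto simp: inj_on_def)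
  moreover have "(\<Sum>v\<in>vertices0 \<tau>. v) = (\<Sum>v\<in>V0. v + \<tau>)"
    unfolding vertices0_def by (subst sum.reindex) (auto simp: inj_on_def)
  then have "(\<Sum>v\<in>vertices0 \<tau>. v) = (\<Sum>v\<in>V0. v) + of_nat k * \<tau>"
    by (simp add: sum.distrib k_def)
  ultimately show ?thesis
    using k_pos by (simp add: barycenter_def scaleR_conv_of_real distrib_left flip: k_def)
qed

lemma barycenter_vertices_K1: "barycenter vertices_K1 = of_real L * b0"
proof -
  have inj: "inj_on (\<lambda>x. L *\<^sub>R x) V0"
    using L_gt_1 by (auto simp: inj_on_def)
  have "card vertices_K1 = k"
    unfolding vertices_K1_def k_def using inj by (rule card_image)
  moreover have "(\<Sum>v\<in>vertices_K1. v) = L *\<^sub>R (\<Sum>v\<in>V0. v)"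
    unfolding vertices_K1_def using inj by (subst sum.reindex) (auto simp: scaleR_sum_right)
  ultimately show ?thesis
    by (simp add: barycenter_def scaleR_conv_of_real flip: k_def)
qed

lemma level1_shift:
  assumes "m \<in> {1..N}"
  defines "\<tau> \<equiv> L *\<^sub>R \<nu> m"
  shows "\<tau> \<in> shifts0" "complex0 \<tau> \<subseteq> K_level 1" "b0 + \<tau> = of_real L * b0 + c * cell c m"
proof -
  show K1: "complex0 \<tau> \<subseteq> K_level 1"
  proof
    fix x assume "x \<in> complex0 \<tau>"
    then obtain y where y: "y \<in> K" "x = y + \<tau>"
      unfolding complex0_def by blast
    then have "x = L ^ 1 *\<^sub>R \<Psi> m y"
      using L_gt_1 by (simp add: \<Psi>_def \<tau>_def scaleR_add_right)
    then show "x \<in> K_level 1"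
      unfolding K_level_def using \<Psi>_in_K[OF assms(1) y(1)] by blast
  qed
  then have "complex0 \<tau> \<subseteq> K_infinity"
    unfolding K_infinity_def by blast
  moreover have "\<tau> = (\<Sum>j=1..1. L ^ j *\<^sub>R \<nu> m)"
    by (simp add: \<tau>_def)
  ultimately show "\<tau> \<in> shifts0"
    unfolding shifts0_def using assms(1) by (auto intro!: exI[of _ "1 :: nat"] exI[of _ "\<lambda>_. m"])
  show "b0 + \<tau> = of_real L * b0 + c * cell c m"
    using c_nonzero by (simp add: cell_eq \<tau>_def scaleR_conv_of_real)
qed

text \<open>Measured from \<open>w\<close>, angles grow by \<open>2 * pi * i / k\<close>. Arguments
  \<open>t \<le> 0\<close> in the sector thus belong to area \<open>i\<close>, positive ones to area
  \<open>i + 1\<close>.\<close>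

lemma sector_in_slices:
  assumes w: "w = of_real L * (b0 + c * rt k (- int i))" and m: "m \<in> {1..N}" "cell c m \<in> sector k"
  shows "complex0 (L *\<^sub>R \<nu> m) \<in> slice w i \<union> slice w (i + 1)"
proof -
  obtain r t where t: "cell c m = rcis r t" "0 < r" "- 2 * pi / of_nat k < t" "t \<le> 2 * pi / of_nat k"
    using m(2) unfolding sector_def by blast
  define s where "s = t + 2 * pi * of_nat i / of_nat k"
  define b where "b = of_real L * b0"
  have "cis s = cis t * rt k (int i)"
    by (simp add: s_def rt_def cis_mult)
  then have "cis s * (w - b) = of_real L * (cis t * c)"
    by (simp add: w b_def algebra_simps)
  then have "b + (r / L) *\<^sub>R (cis s * (w - b)) = b + c * cell c m"
    using L_gt_1 by (simp add: t(1) rcis_def scaleR_conv_of_real)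
  then have center: "barycenter (vertices0 (L *\<^sub>R \<nu> m)) = b + (r / L) *\<^sub>R (cis s * (w - b))"
    using level1_shift(3)[OF m(1)] by (simp add: barycenter_vertices0 b_def)
  have "0 < r / L"
    using t(2) L_gt_1 by simp
  have area: "barycenter (vertices0 (L *\<^sub>R \<nu> m)) \<in> area w j"
    if "2 * pi * (real j - 1) / real k < s" "s \<le> 2 * pi * real j / real k" for j
    unfolding center area_def Let_def barycenter_vertices_K1 b_def
    using that \<open>0 < r / L\<close> by blast
  have "2 * pi * (real i - 1) / real k = 2 * pi * of_nat i / of_nat k + - 2 * pi / real k"
    "2 * pi * real (i + 1) / real k = 2 * pi * of_nat i / of_nat k + 2 * pi / real k"
    by (simp_all add: algebra_simps add_divide_distrib diff_divide_distrib)
  then have "barycenter (vertices0 (L *\<^sub>R \<nu> m)) \<in> area w i \<union> area w (i + 1)"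
    using area[of i] area[of "i + 1"] t(3,4) by (cases "t \<le> 0") (simp_all add: s_def)
  then show ?thesis
    unfolding slice_def using level1_shift(1,2)[OF m(1)] by blast
qed

text \<open>The rotation of a complex maps \<open>V0\<close> to itself, so it is given by a root of
  unity. Injectivity of \<open>l0\<close> turns equal labels at a common vertex into the equation
  between roots of unity.\<close>

lemma well_labels_if_well_labelable:
  assumes "well_labelable A D" and D: "\<And>m. \<lbrakk>m \<in> {1..N}; cell c m \<in> S\<rbrakk> \<Longrightarrow> complex0 (L *\<^sub>R \<nu> m) \<in> D"
  obtains u where "well_labels k (cells \<inter> S) u"
proof -
  obtain l0 l where l: "bij_betw l0 V0 A"
    "\<And>\<tau>. \<lbrakk>\<tau> \<in> shifts0; complex0 \<tau> \<in> D\<rbrakk> \<Longrightarrow> \<exists>R\<in>rotations0. \<forall>v\<in>vertices0 \<tau>. l v = l0 (R (v - \<tau>))"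
    using assms(1) unfolding well_labelable_def by blast
  have "\<exists>u. u ^ k = 1 \<and> (\<forall>p. p ^ k = 1 \<longrightarrow> l (of_real L * b0 + c * (z + p)) = l0 (b0 + c * (u * p)))"
    if z: "z \<in> cells \<inter> S" for z
  proof -
    obtain m where m: "m \<in> {1..N}" "z = cell c m"
      using z by blast
    then have "complex0 (L *\<^sub>R \<nu> m) \<in> D"
      using D z by blast
    then obtain R where R: "R \<in> rotations0"
      "\<And>v. v \<in> vertices0 (L *\<^sub>R \<nu> m) \<Longrightarrow> l v = l0 (R (v - L *\<^sub>R \<nu> m))"
      using l(2) level1_shift(1)[OF m(1)] by blast
    obtain t where t: "R = (\<lambda>z. b0 + cis t * (z - b0))" "R ` V0 = V0"
      using R(1) unfolding rotations0_def by blast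
    have "R (b0 + c) \<in> V0"
      using t(2) base by blast
    then have "cis t ^ k = 1"
      using in_V0_iff[of "cis t"] by (simp add: t(1) mult.commute)
    moreover have "l (of_real L * b0 + c * (z + p)) = l0 (b0 + c * (cis t * p))" if p: "p ^ k = 1" for p
    proof -
      have "b0 + c * p \<in> V0"
        using p in_V0_iff by blast
      then have "l (b0 + c * p + L *\<^sub>R \<nu> m) = l0 (R (b0 + c * p))"
        using R(2)[of "b0 + c * p + L *\<^sub>R \<nu> m"] by (auto simp: vertices0_def)
      moreover have "b0 + c * p + L *\<^sub>R \<nu> m = of_real L * b0 + c * (z + p)"
        using level1_shift(3)[OF m(1)] by (simp add: m(2) algebra_simps)
      ultimately show ?thesis
        by (simp add: t(1) mult_ac)
    qed
    ultimately show ?thesis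
      by blast
  qed
  then obtain u where u: "\<And>z. z \<in> cells \<inter> S \<Longrightarrow> u z ^ k = 1"
    "\<And>z p. \<lbrakk>z \<in> cells \<inter> S; p ^ k = 1\<rbrakk> \<Longrightarrow> l (of_real L * b0 + c * (z + p)) = l0 (b0 + c * (u z * p))"
    by metis
  have "well_labels k (cells \<inter> S) u"
    unfolding well_labels_def
  proof (intro conjI ballI allI impI)
    fix z z' p q
    assume z: "z \<in> cells \<inter> S" "z' \<in> cells \<inter> S" and pq: "p ^ k = 1" "q ^ k = 1" "z + p = z' + q"
    have "l0 (b0 + c * (u z * p)) = l0 (b0 + c * (u z' * q))"
      using u(2)[OF z(1) pq(1)] u(2)[OF z(2) pq(2)] pq(3) by simp
    moreover have "b0 + c * (u z * p) \<in> V0" "b0 + c * (u z' * q) \<in> V0"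
      using u(1) z pq in_V0_iff by (simp_all add: power_mult_distrib)
    ultimately have "b0 + c * (u z * p) = b0 + c * (u z' * q)"
      using bij_betw_imp_inj_on[OF l(1)] by (auto dest: inj_onD)
    then show "u z * p = u z' * q"
      using c_nonzero by simp
  qed (rule u(1))
  then show thesis
    by (rule that)
qed

text \<open>A cell centered at 0 belongs to a map fixing \<open>b0\<close>, and fixed points lie in
  \<open>K\<close>. This is how the condition on hexagons excludes a center cell.\<close>

lemma center_cell_imp_center_in_K:
  assumes "0 \<in> cells"
  shows "barycenter vertices_K1 \<in> K_level 1"
proof -
  obtain m where m: "m \<in> {1..N}" "cell c m = 0"
    using assms by force
  then have "\<Psi> m b0 = b0"
    using c_nonzero L_gt_1 by (simp add: cell_def)
  then have "b0 \<in> K"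
    using fixed_point_in_K m(1) by blast
  then show ?thesis
    unfolding barycenter_vertices_K1 K_level_def by (auto simp: scaleR_conv_of_real)
qed

end

theorem theorem3p2:
  fixes L :: real and N :: nat and \<nu> :: "nat \<Rightarrow> complex" and K :: "complex set"
    and A :: "'l set" and w :: complex and i :: nat
  defines "k \<equiv> similitude_system.k L N \<nu>"
    and "B1 \<equiv> barycenter (similitude_system.vertices_K1 L N \<nu>)"
    and "K1 \<equiv> similitude_system.K_level L K 1"
    and "W \<equiv> similitude_system.slice L N \<nu> K w"
  assumes "simple_nested_fractal L N \<nu> K"
    and "3 \<le> k"
    and "finite A" and "card A = k"
    and "k \<noteq> 6 \<or> (k = 6 \<and> B1 \<notin> K1)"
    and "w \<in> similitude_system.vertices_K1 L N \<nu>"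
    and "i \<in> {1..k}"
  shows "similitude_system.GLP L N \<nu> K A \<longleftrightarrow>
    similitude_system.well_labelable L N \<nu> K A (W i \<union> W (i + 1))"
proof -
  interpret simple_nested_fractal L N \<nu> K
    by fact
  have k_ge_3: "3 \<le> similitude_system.k L N \<nu>"
    using assms(6) by (simp add: assms(1))
  obtain w0 where w0: "w0 \<in> V0" "w = L *\<^sub>R w0"
    using assms(10) unfolding vertices_K1_def by blast
  \<comment> \<open>Turning the base vertex by \<open>i\<close> steps puts the half-line between
    slices \<open>i\<close> and \<open>i + 1\<close> on the positive real axis.\<close>
  define c where "c = (w0 - b0) * rt k (int i)"
  have "rt k (int i) ^ k = 1"
    using k_ge_3 rt_power[of k "int i"] by (simp add: assms(1))
  then have "b0 + c \<in> V0"
    by (subst regular_polygon(3)[OF k_ge_3 w0(1)]) (auto simp: c_def assms(1))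
  then interpret fractal_with_base L N \<nu> K c
    using k_ge_3 by unfold_locales
  have "w0 - b0 = c * rt k (- int i)"
    by (simp add: c_def mult.assoc)
  then have w: "w = of_real L * (b0 + c * rt k (- int i))"
    by (simp add: w0(2) scaleR_conv_of_real algebra_simps)
  show ?thesis
  proof
    assume "GLP A"
    then show "well_labelable A (W i \<union> W (i + 1))"
      by (rule well_labelable_if_GLP)
  next
    assume "well_labelable A (W i \<union> W (i + 1))"
    moreover have "complex0 (L *\<^sub>R \<nu> m) \<in> W i \<union> W (i + 1)"
      if "m \<in> {1..N}" "cell c m \<in> sector k" for m
      using sector_in_slices[OF w[unfolded assms(1)] that[unfolded assms(1)]] unfolding assms(4) .
    ultimately obtain u where "well_labels k (cells \<inter> sector k) u"
      using well_labels_if_well_labelable[of A "W i \<union> W (i + 1)" "sector k"] unfolding assms(1) by blast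
    moreover have "0 \<notin> cells" if "k = 6"
      using that assms(9) center_cell_imp_center_in_K by (auto simp: assms(2,3))
    ultimately obtain U where "well_labels k cells U"
      using extend_sector_labels by (auto simp: assms(1))
    then show "GLP A"
      using GLP_if_well_labels assms(7,8) by (simp add: assms(1))
  qed
qed

end
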